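(* Fix $q>0$ and $\lambda>0$. Then $$\lim_{n\to\infty}\frac{1}{n}\log Z_{n,\lambda,q}[L]=\lim_{r\to\infty}\lim_{n\to\infty}\frac{1}{n}\log Z_{n,\lambda,q}[B_r\cap L]=\Psi\big(\tfrac{\lambda}{q}\big)-\big(\tfrac{q-1}{2q}\big)\lambda+\log q,$$ where $L$ is the event that $K_n(\omega)$ is acyclic and $B_r$ is the event that $K_n(\omega)$ contains no connected components of size larger than $r$. Moreover, (for fixed $q$) convergence is uniform for $\lambda$ belonging to compact subsets of $(0,\infty)\setminus\{q\}$.
   Context: Let $K_n=(V_n,E_n)$ be the complete graph on $n$ vertices. For $\omega\in\{0,1\}^{E_n}$ let $K_n(\omega)$ be the graph on $V_n$ with edge set $\{e\in E_n:\omega_e=1\}$, and let $k(\omega)$ be its number of connected components (isolated vertices count as components). The size of a component is its number of vertices. For $q>0$, $\lambda>0$, $n\ge\lambda$, put $p=\lambda/n$, and for an event $A\subset\{0,1\}^{E_n}$ define the unnormalised random cluster weight $$Z_{n,\lambda,q}[A]=\sum_{\omega\in A}\Big\{\prod_{e\in E_n}p^{\omega_e}(1-p)^{1-\omega_e}\Big\}q^{k(\omega)}.$$ Let $\Psi(x)=\big(\log x-\tfrac12[x-\tfrac1x]\big)\wedge 0$ for $x>0$, where $a\wedge b=\min\{a,b\}$. *)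

theory Defs
  imports "HOL-Analysis.Analysis"
begin

definition K_edges :: "nat \<Rightarrow> nat set set" where
  "K_edges n = {e. e \<subseteq> {..<n} \<and> card e = 2}"

definition configs :: "nat \<Rightarrow> (nat set \<Rightarrow> nat) set" where
  "configs n = K_edges n \<rightarrow>\<^sub>E {0, 1}"

definition open_edges :: "nat \<Rightarrow> (nat set \<Rightarrow> nat) \<Rightarrow> nat set set" where
  "open_edges n \<omega> = {e \<in> K_edges n. \<omega> e = 1}"

definition adjacency :: "nat \<Rightarrow> (nat set \<Rightarrow> nat) \<Rightarrow> (nat \<times> nat) set" where
  "adjacency n \<omega> = {(u, v). {u, v} \<in> open_edges n \<omega>}"

text \<open>The closure is reflexive on all of \<open>nat\<close>, but the quotient only
  contains the classes of the vertices \<open>{..<n}\<close>; isolated vertices give singletons.\<close>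

definition components_of_config :: "nat \<Rightarrow> (nat set \<Rightarrow> nat) \<Rightarrow> nat set set" where
  "components_of_config n \<omega> = {..<n} // (adjacency n \<omega>)\<^sup>*"

definition num_components :: "nat \<Rightarrow> (nat set \<Rightarrow> nat) \<Rightarrow> nat" where
  "num_components n \<omega> = card (components_of_config n \<omega>)"

definition is_graph_cycle :: "nat set set \<Rightarrow> nat list \<Rightarrow> bool" where
  "is_graph_cycle F vs \<longleftrightarrow> 3 \<le> length vs \<and> distinct vs \<and>
     (\<forall>i<length vs. {vs ! i, vs ! (Suc i mod length vs)} \<in> F)"

definition event_L :: "nat \<Rightarrow> (nat set \<Rightarrow> nat) set" where
  "event_L n = {\<omega> \<in> configs n. \<not> (\<exists>vs. is_graph_cycle (open_edges n \<omega>) vs)}"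

definition event_B :: "nat \<Rightarrow> nat \<Rightarrow> (nat set \<Rightarrow> nat) set" where
  "event_B n r = {\<omega> \<in> configs n. \<not> (\<exists>C \<in> components_of_config n \<omega>. card C > r)}"

definition rc_weight :: "nat \<Rightarrow> real \<Rightarrow> real \<Rightarrow> (nat set \<Rightarrow> nat) set \<Rightarrow> real" where
  "rc_weight n l q A =
     (let p = l / real n in
      \<Sum>\<omega>\<in>A. (\<Prod>e\<in>K_edges n. p ^ \<omega> e * (1 - p) ^ (1 - \<omega> e)) * q ^ num_components n \<omega>)"

definition Psi :: "real \<Rightarrow> real" where
  "Psi x = min (ln x - (x - 1 / x) / 2) 0"

end

theory Submission
  imports Defs "HOL-Computational_Algebra.Formal_Power_Series"
begin

text \<open>
  A forest on \<open>n\<close> vertices with \<open>k\<close> components has \<open>n - k\<close> edges. Therefore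
  the random cluster weight of the acyclic configurations is
  \<open>(1 - p) ^ (n choose 2) * q ^ n\<close> times the forest polynomial, the sum of
  \<open>t ^ |F|\<close> over all forests \<open>F\<close>, at \<open>t = p / (q * (1 - p))\<close>, which is close to
  \<open>x / n\<close> for \<open>x = \<lambda> / q\<close>. The prefactor accounts for \<open>ln q - \<lambda> / 2\<close>, and
  it remains to show that the forest polynomial at \<open>x / n\<close> grows like \<open>exp (n * forest_rate x)\<close>
  with \<open>forest_rate x = x / 2\<close> for \<open>x \<le> 1\<close> and \<open>forest_rate x = ln x + 1 / (2 * x)\<close> for
  \<open>x > 1\<close>; by \<open>Psi_eq_forest_rate\<close> this is the asserted limit.

  The supercritical case \<open>x > 1\<close> rests on generating functions. Pitman's double counting
  (\<open>rooted_forest_recursion\<close>) gives Cayley's formula, and marking a component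
  (\<open>mark_component\<close>) gives the exponential formula (\<open>forest_sum_eq_fps\<close>): forests with weight
  \<open>c\<close> per component have the exponential generating function \<open>exp (c * U)\<close>, where
  \<open>U\<close> is the series of labelled trees. At its radius of convergence \<open>1 / e\<close> the series
  \<open>U\<close> has the value \<open>1 / 2\<close>, and the series of rooted trees has the value \<open>1\<close>
  (\<open>tree_coeff_sums\<close>, \<open>rooted_coeff_sums\<close>). Evaluation at this point gives the upper bound
  \<open>forest_fps_upper\<close>. For the lower bound \<open>forest_fps_lower\<close>, Markov's inequality shows
  that small trees typically use up fewer than \<open>n\<close> vertices, and one giant tree takes the rest.

  For \<open>x \<le> 1\<close> no further enumeration is needed: raising \<open>x\<close> to \<open>y\<close> raises the
  growth rate by at most \<open>(y - x) / 2\<close> (\<open>growth_rate_add\<close>). From \<open>0\<close> to \<open>x\<close>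
  this is the upper bound, and from \<open>x\<close> to points just above \<open>1\<close> it is the lower bound.

  With component sizes restricted to at most \<open>r\<close>, the logarithms of the coefficients of
  \<open>exp (n * c * U)\<close> are superadditive in \<open>n\<close>. Fekete's lemma thus gives the limit
  \<open>n \<rightarrow> \<infinity>\<close> as a supremum; for \<open>n \<le> r\<close> the restriction is void, and hence the
  limits for \<open>r \<rightarrow> \<infinity>\<close> recover the unrestricted growth rate (\<open>limit_rate_lim\<close>).
  Finally, since a forest has at most \<open>n\<close> edges, all growth rates are Lipschitz with constant
  \<open>1\<close> in \<open>ln x\<close>, and pointwise limits are automatically uniform on compact sets.
\<close>

section \<open>Forests and their components\<close>

definition adj :: "nat set set \<Rightarrow> (nat \<times> nat) set" where
  "adj F = {(u, v). {u, v} \<in> F}"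

definition conn :: "nat set set \<Rightarrow> (nat \<times> nat) set" where
  "conn F = (adj F)\<^sup>*"

text \<open>The relation \<open>conn F\<close> is reflexive on all natural numbers, so the vertex set
  has to be supplied when its classes are counted.\<close>

definition comps :: "nat set \<Rightarrow> nat set set \<Rightarrow> nat set set" where
  "comps V F = V // conn F"

definition pairs :: "nat set \<Rightarrow> nat set set" where
  "pairs V = {e. e \<subseteq> V \<and> card e = 2}"

text \<open>Acyclicity in the form used for counting: every edge is a bridge. A loop \<open>{u}\<close>
  would violate it by reflexivity of \<open>conn\<close>. Deleting and adding edges, as well as
  splitting a graph into components, are simpler to follow with bridges than with cycles;
  \<open>acyc_iff_no_cycle\<close> connects the two.\<close>

definition acyc :: "nat set set \<Rightarrow> bool" where
  "acyc F \<longleftrightarrow> (\<forall>u v. {u, v} \<in> F \<longrightarrow> (u, v) \<notin> conn (F - {{u, v}}))"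

definition forests :: "nat set \<Rightarrow> nat set set set" where
  "forests V = {F. F \<subseteq> pairs V \<and> acyc F}"

lemma pairsE:
  assumes "e \<in> pairs V"
  obtains u v where "e = {u, v}" "u \<noteq> v" "u \<in> V" "v \<in> V"
  using assms unfolding pairs_def by (auto simp: card_2_iff)

lemma pairs_mem_iff: "{u, v} \<in> pairs V \<longleftrightarrow> u \<noteq> v \<and> u \<in> V \<and> v \<in> V"
  unfolding pairs_def by (auto simp: card_2_iff card_insert_if)

lemma finite_pairs [simp]: "finite V \<Longrightarrow> finite (pairs V)"
  unfolding pairs_def by (rule finite_subset[of _ "Pow V"]) auto

lemma conn_refl [simp]: "(x, x) \<in> conn F"
  by (simp add: conn_def)

lemma conn_sym: "(x, y) \<in> conn F \<Longrightarrow> (y, x) \<in> conn F"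
proof -
  have "sym (adj F)" by (auto simp: sym_def adj_def insert_commute)
  then show "(x, y) \<in> conn F \<Longrightarrow> (y, x) \<in> conn F"
    unfolding conn_def by (meson sym_rtrancl symE)
qed

lemma conn_trans: "(x, y) \<in> conn F \<Longrightarrow> (y, z) \<in> conn F \<Longrightarrow> (x, z) \<in> conn F"
  by (simp add: conn_def)

lemma conn_edge: "{u, v} \<in> F \<Longrightarrow> (u, v) \<in> conn F"
  by (auto simp: conn_def adj_def)

lemma conn_mono: "F \<subseteq> F' \<Longrightarrow> conn F \<subseteq> conn F'"
  unfolding conn_def by (rule rtrancl_mono) (auto simp: adj_def)

lemma conn_empty [simp]: "conn {} = Id"
  by (auto simp: conn_def adj_def)

lemma equiv_conn: "equiv UNIV (conn F)"
proof (rule equivI)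
  show "sym (conn F)" using conn_sym by (auto intro: symI)
  show "trans (conn F)" using conn_trans by (auto intro: transI)
qed (auto intro: refl_onI)

lemma class_eq_iff: "conn F `` {x} = conn F `` {y} \<longleftrightarrow> (x, y) \<in> conn F"
  using eq_equiv_class_iff[OF equiv_conn] by auto

lemma comps_image: "comps V F = (\<lambda>x. conn F `` {x}) ` V"
  by (auto simp: comps_def quotient_def)

lemma finite_comps [simp]: "finite V \<Longrightarrow> finite (comps V F)"
  by (simp add: comps_image)

lemma conn_closed:
  assumes "F \<subseteq> pairs V" "(x, y) \<in> conn F" "x \<in> V"
  shows "y \<in> V"
  using assms(2,3) unfolding conn_def
proof (induction rule: rtrancl_induct)
  case (step y z)
  then have "{y, z} \<in> pairs V" using assms(1) by (auto simp: adj_def)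
  then show ?case by (simp add: pairs_mem_iff)
qed

lemma comps_subset: "F \<subseteq> pairs V \<Longrightarrow> C \<in> comps V F \<Longrightarrow> C \<subseteq> V"
  using conn_closed unfolding comps_image by blast

lemma comps_nonempty: "C \<in> comps V F \<Longrightarrow> C \<noteq> {}"
  unfolding comps_image using conn_refl by blast

lemma Union_comps: "F \<subseteq> pairs V \<Longrightarrow> \<Union>(comps V F) = V"
  using comps_subset[of F V] conn_refl unfolding comps_image by blast

lemma comps_disjoint: "C \<in> comps V F \<Longrightarrow> D \<in> comps V F \<Longrightarrow> C \<noteq> D \<Longrightarrow> C \<inter> D = {}"
  using quotient_disj[OF equiv_conn, of C F D] unfolding comps_def quotient_def by blast

lemma comp_eq_class: "C \<in> comps V F \<Longrightarrow> x \<in> C \<Longrightarrow> C = conn F `` {x}"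
  unfolding comps_image using class_eq_iff by blast

text \<open>A path using the new edge can be cut at the edge, and one passage in one of the two
  directions is enough.\<close>

lemma conn_insert:
  "conn (insert {u, v} F) = conn F \<union> {(x, y). (x, u) \<in> conn F \<and> (v, y) \<in> conn F}
     \<union> {(x, y). (x, v) \<in> conn F \<and> (u, y) \<in> conn F}" (is "?L = ?R")
proof
  have e: "(u, v) \<in> ?L" "(v, u) \<in> ?L"
    by (rule conn_edge, simp) (rule conn_edge, simp add: insert_commute)
  have m: "conn F \<subseteq> ?L" by (rule conn_mono) auto
  show "?R \<subseteq> ?L"
    using e m by (auto simp: subset_iff) (meson conn_trans)+
  show "?L \<subseteq> ?R"
  proof (rule subrelI)
    fix x y assume "(x, y) \<in> ?L"
    then show "(x, y) \<in> ?R" unfolding conn_def[of "insert _ _"]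
    proof (induction rule: rtrancl_induct)
      case base show ?case by simp
    next
      case (step y z)
      from step(2) have "(y, z) \<in> conn F \<or> (y = u \<and> z = v) \<or> (y = v \<and> z = u)"
        by (auto simp: adj_def doubleton_eq_iff intro: conn_edge)
      then show ?case
      proof (elim disjE conjE)
        assume "(y, z) \<in> conn F"
        with step(3) show ?case by (auto dest: conn_trans)
      next
        assume "y = u" "z = v"
        with step(3) conn_sym show ?case by auto
      next
        assume "y = v" "z = u"
        with step(3) conn_sym show ?case by auto
      qed
    qed
  qed
qed

lemma acyc_mono: "acyc F \<Longrightarrow> F' \<subseteq> F \<Longrightarrow> acyc F'"
  unfolding acyc_def using conn_mono by (meson Diff_mono equalityE subset_iff)

text \<open>The new edge is a bridge exactly if it joins different classes. An old edge
  \<open>{a, b}\<close> stays a bridge: a detour through the new edge would connect \<open>u\<close> and \<open>v\<close>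
  within \<open>F\<close>, along the old edge.\<close>

lemma acyc_insert:
  assumes "{u, v} \<notin> F"
  shows "acyc (insert {u, v} F) \<longleftrightarrow> acyc F \<and> (u, v) \<notin> conn F"
proof (intro iffI conjI)
  assume a: "acyc (insert {u, v} F)"
  show "acyc F" using a by (rule acyc_mono) auto
  have "insert {u, v} F - {{u, v}} = F" using assms by auto
  then show "(u, v) \<notin> conn F" using a unfolding acyc_def by (metis insertI1)
next
  assume a: "acyc F \<and> (u, v) \<notin> conn F"
  show "acyc (insert {u, v} F)" unfolding acyc_def
  proof (intro allI impI)
    fix a b assume ab: "{a, b} \<in> insert {u, v} F"
    show "(a, b) \<notin> conn (insert {u, v} F - {{a, b}})"
    proof (cases "{a, b} = {u, v}")
      case True
      then have "insert {u, v} F - {{a, b}} = F" using assms by auto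
      moreover have "(a, b) \<notin> conn F" using a True conn_sym by (metis doubleton_eq_iff)
      ultimately show ?thesis by simp
    next
      case False
      let ?F = "F - {{a, b}}"
      have eq: "insert {u, v} F - {{a, b}} = insert {u, v} ?F" using False by auto
      have abF: "{a, b} \<in> F" using ab False by auto
      have n: "(a, b) \<notin> conn ?F" using a abF by (auto simp: acyc_def)
      have m: "conn ?F \<subseteq> conn F" by (rule conn_mono) auto
      have c: "(a, b) \<in> conn F" by (rule conn_edge[OF abF])
      have "\<not> ((a, u) \<in> conn ?F \<and> (v, b) \<in> conn ?F)" "\<not> ((a, v) \<in> conn ?F \<and> (u, b) \<in> conn ?F)"
        using m c a by (meson conn_sym conn_trans subsetD)+
      then show ?thesis unfolding eq conn_insert using n by auto
    qed
  qed
qed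

lemma comps_insert:
  assumes "u \<in> V" "v \<in> V" "(u, v) \<notin> conn F"
  shows "comps V (insert {u, v} F)
    = insert (conn F `` {u} \<union> conn F `` {v}) (comps V F - {conn F `` {u}, conn F `` {v}})" (is "_ = ?R")
proof -
  let ?c = "\<lambda>x. conn F `` {x}"
  have cl: "conn (insert {u, v} F) `` {x} =
      (if ?c x = ?c u \<or> ?c x = ?c v then ?c u \<union> ?c v else ?c x)" for x
  proof -
    have "(x, u) \<in> conn F \<longleftrightarrow> ?c x = ?c u" "(x, v) \<in> conn F \<longleftrightarrow> ?c x = ?c v"
      by (simp_all add: class_eq_iff)
    moreover have "?c u \<noteq> ?c v" using assms(3) by (simp add: class_eq_iff)
    moreover have "conn (insert {u, v} F) `` {x} = ?c x \<union> (if (x, u) \<in> conn F then ?c v else {})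
       \<union> (if (x, v) \<in> conn F then ?c u else {})"
      unfolding conn_insert by auto
    ultimately show ?thesis by auto
  qed
  have "comps V (insert {u, v} F) = (\<lambda>C. if C = ?c u \<or> C = ?c v then ?c u \<union> ?c v else C) ` comps V F"
    unfolding comps_image image_image cl ..
  also have "\<dots> = ?R"
  proof -
    have "?c u \<in> comps V F" using assms(1) by (simp add: comps_image)
    then show ?thesis by (intro set_eqI iffI) (auto split: if_splits)
  qed
  finally show ?thesis .
qed

lemma forests_finite [simp]: "finite V \<Longrightarrow> finite (forests V)"
  unfolding forests_def by (rule finite_subset[of _ "Pow (pairs V)"]) auto

lemma comps_empty: "comps V {} = (\<lambda>x. {x}) ` V"
  by (auto simp: comps_image)

lemma merged_notin_comps:
  assumes "(u, v) \<notin> conn F"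
  shows "conn F `` {u} \<union> conn F `` {v} \<notin> comps V F"
proof
  assume a: "conn F `` {u} \<union> conn F `` {v} \<in> comps V F"
  then have "conn F `` {u} \<union> conn F `` {v} = conn F `` {u}" using comp_eq_class[OF a, of u] by auto
  moreover have "v \<in> conn F `` {u} \<union> conn F `` {v}" by auto
  ultimately show False using assms by auto
qed

lemma card_comps_insert:
  assumes "finite V" "u \<in> V" "v \<in> V" "(u, v) \<notin> conn F"
  shows "card (comps V F) = Suc (card (comps V (insert {u, v} F)))"
proof -
  let ?U = "conn F `` {u}" and ?W = "conn F `` {v}"
  have UW: "?U \<in> comps V F" "?W \<in> comps V F" "?U \<noteq> ?W"
    using assms by (auto simp: comps_image class_eq_iff)
  have "?U \<union> ?W \<notin> comps V F" by (rule merged_notin_comps[OF assms(4)])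
  then have "card (comps V (insert {u, v} F)) = Suc (card (comps V F - {?U, ?W}))"
    unfolding comps_insert[OF assms(2-4)] using assms(1) by simp
  also have "card (comps V F - {?U, ?W}) = card (comps V F) - 2"
    using UW assms(1) by (subst card_Diff_subset) auto
  also have "card (comps V F) \<ge> 2"
    using card_mono[of "comps V F" "{?U, ?W}"] UW assms(1) by auto
  ultimately show ?thesis
    by linarith
qed

text \<open>Each edge of a forest lowers the number of components by one. Through this identity the
  weight \<open>q\<close> per component can be traded for a weight per edge.\<close>

lemma forest_card:
  assumes "finite V" "F \<in> forests V"
  shows "card (comps V F) + card F = card V"
proof -
  have "finite F" using assms finite_subset[OF _ finite_pairs] by (auto simp: forests_def)
  moreover have "F \<subseteq> pairs V" "acyc F" using assms by (auto simp: forests_def)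
  ultimately show ?thesis
  proof (induction F rule: finite_induct)
    case empty
    then show ?case by (simp add: comps_empty card_image)
  next
    case (insert e F)
    obtain u v where e: "e = {u, v}" "u \<in> V" "v \<in> V"
      using insert.prems by (metis insert_subset pairsE)
    have "acyc F" "(u, v) \<notin> conn F" using insert.prems insert.hyps acyc_insert e by auto
    then show ?case
      using insert card_comps_insert[OF assms(1) e(2,3)] e by auto
  qed
qed

section \<open>Bridges and cycles\<close>

lemma rtrancl_distinct_path:
  assumes "(u, v) \<in> r\<^sup>*"
  shows "\<exists>xs. distinct xs \<and> xs \<noteq> [] \<and> hd xs = u \<and> last xs = v \<and> successively (\<lambda>a b. (a, b) \<in> r) xs"
  using assms
proof (induction rule: rtrancl_induct)
  case base
  show ?case by (rule exI[of _ "[u]"]) auto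
next
  case (step y z)
  then obtain xs where xs: "distinct xs" "xs \<noteq> []" "hd xs = u" "last xs = y"
    "successively (\<lambda>a b. (a, b) \<in> r) xs" by blast
  show ?case
  proof (cases "z \<in> set xs")
    case True
    then obtain as bs where eq: "xs = as @ z # bs" by (meson split_list)
    show ?thesis
      by (rule exI[of _ "as @ [z]"]) (use xs eq in \<open>auto simp: successively_append_iff hd_append split: if_splits\<close>)
  next
    case False
    show ?thesis
      by (rule exI[of _ "xs @ [z]"]) (use xs step False in \<open>auto simp: successively_append_iff\<close>)
  qed
qed

text \<open>The closing edge of a cycle is not a bridge, because the rest of the cycle connects its
  ends. Conversely, a non-bridge closes a repetition-free path between its ends to a cycle; that
  path has at least three vertices as it avoids the edge.\<close>

lemma acyc_iff_no_cycle:
  assumes "F \<subseteq> pairs V"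
  shows "acyc F \<longleftrightarrow> \<not> (\<exists>vs. is_graph_cycle F vs)"
proof
  assume a: "acyc F"
  show "\<not> (\<exists>vs. is_graph_cycle F vs)"
  proof
    assume "\<exists>vs. is_graph_cycle F vs"
    then obtain vs where len: "3 \<le> length vs" and d: "distinct vs"
      and E: "\<And>i. i < length vs \<Longrightarrow> {vs ! i, vs ! (Suc i mod length vs)} \<in> F"
      by (auto simp: is_graph_cycle_def)
    let ?m = "length vs - 1"
    let ?e = "{vs ! 0, vs ! ?m}"
    have step: "{vs ! i, vs ! Suc i} \<in> F - {?e}" if i: "Suc i < length vs" for i
    proof -
      have inj: "vs ! j = vs ! k \<longleftrightarrow> j = k" if "j < length vs" "k < length vs" for j k
        using nth_eq_iff_index_eq[OF d that] .
      have l: "i < length vs" "0 < length vs" "?m < length vs" using i len by linarith+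
      have "{vs ! i, vs ! Suc i} = ?e \<longleftrightarrow> i = 0 \<and> Suc i = ?m \<or> i = ?m \<and> Suc i = 0"
        unfolding doubleton_eq_iff inj[OF l(1,2)] inj[OF l(1,3)] inj[OF i l(2)] inj[OF i l(3)] ..
      then have "{vs ! i, vs ! Suc i} \<noteq> ?e" using len by linarith
      then show ?thesis using E[of i] i by auto
    qed
    have "(vs ! 0, vs ! i) \<in> conn (F - {?e})" if "i < length vs" for i
      using that
    proof (induction i)
      case (Suc i)
      then show ?case using step[of i] conn_edge conn_trans by (metis Suc_lessD)
    qed auto
    then have "(vs ! 0, vs ! ?m) \<in> conn (F - {?e})" using len by simp
    moreover have "?e \<in> F"
    proof -
      have "Suc ?m = length vs" using len by linarith
      then have "Suc ?m mod length vs = 0" "?m < length vs" by (simp_all del: Suc_pred)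
      then show ?thesis using E[of ?m] by (simp add: insert_commute)
    qed
    ultimately show False using a by (auto simp: acyc_def)
  qed
next
  assume n: "\<not> (\<exists>vs. is_graph_cycle F vs)"
  show "acyc F" unfolding acyc_def
  proof (intro allI impI notI)
    fix u v assume uv: "{u, v} \<in> F" and c: "(u, v) \<in> conn (F - {{u, v}})"
    have ne: "u \<noteq> v" using uv assms pairs_mem_iff by blast
    obtain xs where xs: "distinct xs" "xs \<noteq> []" "hd xs = u" "last xs = v"
      "successively (\<lambda>a b. (a, b) \<in> adj (F - {{u, v}})) xs"
      using rtrancl_distinct_path[OF c[unfolded conn_def]] by blast
    have st: "{xs ! i, xs ! Suc i} \<in> F - {{u, v}}" if "Suc i < length xs" for i
      using xs(5) that by (auto simp: successively_conv_nth adj_def)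
    have h: "xs ! 0 = u" "xs ! (length xs - 1) = v"
      using xs by (auto simp: hd_conv_nth last_conv_nth)
    have "length xs \<noteq> 1" using h ne by auto
    moreover have "length xs \<noteq> 2" using st[of 0] h by auto
    moreover have "length xs \<noteq> 0" using xs(2) by simp
    ultimately have len: "3 \<le> length xs" by linarith
    have "is_graph_cycle F xs" unfolding is_graph_cycle_def
    proof (intro conjI allI impI)
      fix i assume i: "i < length xs"
      show "{xs ! i, xs ! (Suc i mod length xs)} \<in> F"
      proof (cases "Suc i < length xs")
        case True then show ?thesis using st by auto
      next
        case False
        then have "Suc i = length xs" using i by simp
        then have "i = length xs - 1" "Suc i mod length xs = 0" by auto
        then show ?thesis using h uv by (simp add: insert_commute)
      qed
    qed (use len xs in auto)
    with n show False by blast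
  qed
qed

section \<open>Disjoint unions of graphs\<close>

lemma conn_union_left:
  assumes "F1 \<subseteq> pairs V1" "F2 \<subseteq> pairs V2" "V1 \<inter> V2 = {}" "x \<in> V1"
  shows "(x, y) \<in> conn (F1 \<union> F2) \<longleftrightarrow> (x, y) \<in> conn F1"
proof
  assume "(x, y) \<in> conn (F1 \<union> F2)"
  then show "(x, y) \<in> conn F1" unfolding conn_def[of "F1 \<union> F2"]
  proof (induction rule: rtrancl_induct)
    case (step y z)
    have "y \<in> V1" using conn_closed[OF assms(1) step(3) assms(4)] .
    then have "{y, z} \<notin> F2" using assms(2,3) pairs_mem_iff by blast
    then have "{y, z} \<in> F1"
      using step(2) by (auto simp: adj_def)
    then show ?case using step conn_edge conn_trans by blast
  qed auto
next
  assume "(x, y) \<in> conn F1"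
  then show "(x, y) \<in> conn (F1 \<union> F2)" using conn_mono[of F1 "F1 \<union> F2"] by auto
qed

lemma comps_union:
  assumes "F1 \<subseteq> pairs V1" "F2 \<subseteq> pairs V2" "V1 \<inter> V2 = {}"
  shows "comps (V1 \<union> V2) (F1 \<union> F2) = comps V1 F1 \<union> comps V2 F2"
proof -
  have "conn (F1 \<union> F2) `` {x} = conn F1 `` {x}" if "x \<in> V1" for x
    using conn_union_left[OF assms that] by auto
  moreover have "conn (F1 \<union> F2) `` {x} = conn F2 `` {x}" if "x \<in> V2" for x
    using conn_union_left[OF assms(2,1) _ that] assms(3) by (auto simp: Un_commute Int_commute)
  ultimately show ?thesis unfolding comps_image image_Un by (intro arg_cong2[where f = "(\<union>)"] image_cong) auto
qed

lemma acyc_union: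
  assumes "F1 \<subseteq> pairs V1" "F2 \<subseteq> pairs V2" "V1 \<inter> V2 = {}" "acyc F1" "acyc F2"
  shows "acyc (F1 \<union> F2)"
proof -
  have *: "(u, v) \<notin> conn (F1 \<union> F2 - {{u, v}})"
    if "F1 \<subseteq> pairs V1" "F2 \<subseteq> pairs V2" "V1 \<inter> V2 = {}" "acyc F1" "{u, v} \<in> F1" for F1 F2 V1 V2 u v
  proof -
    have "u \<in> V1" using that pairs_mem_iff by blast
    then have "(u, v) \<in> conn ((F1 - {{u, v}}) \<union> (F2 - {{u, v}})) \<longleftrightarrow> (u, v) \<in> conn (F1 - {{u, v}})"
      by (intro conn_union_left[of _ V1 _ V2]) (use that in auto)
    then show ?thesis using that by (auto simp: acyc_def Un_Diff)
  qed
  have d: "V2 \<inter> V1 = {}" using assms(3) by blast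
  show ?thesis unfolding acyc_def
  proof (intro allI impI)
    fix u v assume "{u, v} \<in> F1 \<union> F2"
    then show "(u, v) \<notin> conn (F1 \<union> F2 - {{u, v}})"
      using *[OF assms(1,2,3,4), of u v] *[OF assms(2,1) d assms(5), of u v]
      unfolding Un_commute[of F2 F1] by blast
  qed
qed

section \<open>Counting rooted forests and trees\<close>

definition forests_with :: "nat set \<Rightarrow> nat \<Rightarrow> nat set set set" where
  "forests_with V m = {F \<in> forests V. card (comps V F) = m}"

definition trees :: "nat set \<Rightarrow> nat set set set" where
  "trees V = {F \<in> forests V. comps V F = {V}}"

text \<open>With \<open>g = real\<close> this counts the ways of choosing one root in every component; with an
  indicator function it restricts the component sizes.\<close>

definition comp_weight :: "(nat \<Rightarrow> real) \<Rightarrow> nat set \<Rightarrow> nat set set \<Rightarrow> real" where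
  "comp_weight g V F = (\<Prod>C\<in>comps V F. g (card C))"

definition forest_sum :: "(nat \<Rightarrow> real) \<Rightarrow> nat set \<Rightarrow> nat \<Rightarrow> real" where
  "forest_sum g V m = (\<Sum>F\<in>forests_with V m. comp_weight g V F)"

lemma finite_forests_with [simp]: "finite V \<Longrightarrow> finite (forests_with V m)"
  by (simp add: forests_with_def)

lemma finite_forest: "finite V \<Longrightarrow> F \<in> forests V \<Longrightarrow> finite F"
  using finite_subset[OF _ finite_pairs] by (auto simp: forests_def)

lemma card_adj:
  assumes "finite V" "F \<subseteq> pairs V"
  shows "card (adj F) = 2 * card F"
proof -
  have "finite F" using assms finite_subset[OF _ finite_pairs] by auto
  then show ?thesis using assms(2)
  proof (induction F rule: finite_induct)
    case empty
    then show ?case by (simp add: adj_def)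
  next
    case (insert e F)
    obtain u v where e: "e = {u, v}" "u \<noteq> v"
      using insert.prems by (metis insert_subset pairsE)
    have "adj (insert e F) = insert (u, v) (insert (v, u) (adj F))"
      unfolding adj_def e by (auto simp: doubleton_eq_iff)
    moreover have "(u, v) \<notin> adj F" "(v, u) \<notin> adj F"
      using insert.hyps e by (auto simp: adj_def insert_commute)
    moreover have "finite (adj F)"
      by (rule finite_subset[of _ "V \<times> V"])
         (use insert.prems assms(1) pairs_mem_iff in \<open>auto simp: adj_def\<close>)
    ultimately show ?case using insert e by auto
  qed
qed

text \<open>Merging classes of sizes \<open>a\<close> and \<open>b\<close> replaces the factor \<open>a * b\<close> by
  \<open>a + b\<close>, and \<open>(a + b) / (a * b) = 1 / a + 1 / b\<close>.\<close>

lemma comp_weight_merge: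
  assumes "finite V" "F \<subseteq> pairs V" "u \<in> V" "v \<in> V" "(u, v) \<notin> conn F"
  shows "comp_weight real V (insert {u, v} F)
    = comp_weight real V F * (1 / card (conn F `` {u}) + 1 / card (conn F `` {v}))"
proof -
  let ?U = "conn F `` {u}" and ?W = "conn F `` {v}" and ?R = "comps V F - {conn F `` {u}, conn F `` {v}}"
  have UW: "?U \<in> comps V F" "?W \<in> comps V F" "?U \<noteq> ?W"
    using assms by (auto simp: comps_image class_eq_iff)
  have f: "finite ?U" "finite ?W"
    using comps_subset[OF assms(2)] UW finite_subset[OF _ assms(1)] by blast+
  have pos: "card ?U > 0" "card ?W > 0" using f comps_nonempty UW by (auto simp: card_gt_0_iff)
  have fin: "finite ?R" using assms(1) by simp
  have "?U \<union> ?W \<notin> ?R" using merged_notin_comps[OF assms(5)] by auto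
  then have 1: "comp_weight real V (insert {u, v} F) = card (?U \<union> ?W) * (\<Prod>C\<in>?R. real (card C))"
    unfolding comp_weight_def comps_insert[OF assms(3-5)] using fin by simp
  have "comps V F = insert ?U (insert ?W ?R)" using UW by auto
  then have "comp_weight real V F = (\<Prod>C\<in>insert ?U (insert ?W ?R). real (card C))"
    unfolding comp_weight_def by metis
  also have "\<dots> = card ?U * (card ?W * (\<Prod>C\<in>?R. real (card C)))"
    using UW fin by (subst prod.insert; auto)+
  finally have 2: "comp_weight real V F = card ?U * (card ?W * (\<Prod>C\<in>?R. real (card C)))" .
  have "card (?U \<union> ?W) = card ?U + card ?W"
    by (rule card_Un_disjoint[OF f comps_disjoint[OF UW]])
  then show ?thesis unfolding 1 2 using pos by (simp add: field_simps)
qed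

text \<open>The vertices of one component contribute \<open>1\<close> in total, which turns a sum over
  components into a sum over vertices.\<close>

lemma sum_inverse_class:
  assumes "finite V" "F \<subseteq> pairs V"
  shows "(\<Sum>v\<in>V. 1 / real (card (conn F `` {v}))) = card (comps V F)"
    and "C \<in> comps V F \<Longrightarrow> (\<Sum>v\<in>C. 1 / real (card (conn F `` {v}))) = 1"
proof -
  have fC: "finite C" if "C \<in> comps V F" for C
    using finite_subset[OF comps_subset[OF assms(2) that] assms(1)] .
  have 1: "(\<Sum>v\<in>C. 1 / real (card (conn F `` {v}))) = 1" if C: "C \<in> comps V F" for C
  proof -
    have "(\<Sum>v\<in>C. 1 / real (card (conn F `` {v}))) = (\<Sum>v\<in>C. 1 / real (card C))"
      by (rule sum.cong[OF refl]) (use comp_eq_class[OF C] in simp)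
    also have "\<dots> = 1" using fC[OF C] comps_nonempty[OF C] by simp
    finally show ?thesis .
  qed
  then show "C \<in> comps V F \<Longrightarrow> (\<Sum>v\<in>C. 1 / real (card (conn F `` {v}))) = 1" .
  have "(\<Sum>v\<in>\<Union>(comps V F). 1 / real (card (conn F `` {v})))
      = (\<Sum>C\<in>comps V F. \<Sum>v\<in>C. 1 / real (card (conn F `` {v})))"
    using comps_disjoint[of _ V F] fC by (subst sum.Union_disjoint) auto
  also have "\<dots> = card (comps V F)" using 1 by simp
  finally show "(\<Sum>v\<in>V. 1 / real (card (conn F `` {v}))) = card (comps V F)"
    by (simp add: Union_comps[OF assms(2)])
qed

text \<open>The pairs are ordered, so that every edge that can be added to the forest occurs twice.\<close>

definition separated_pairs :: "nat set \<Rightarrow> nat set set \<Rightarrow> (nat \<times> nat) set" where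
  "separated_pairs V F = {(u, v). u \<in> V \<and> v \<in> V \<and> (u, v) \<notin> conn F}"

lemma sum_separated_pairs:
  assumes "finite V" "F \<subseteq> pairs V"
  shows "(\<Sum>(u, v)\<in>separated_pairs V F. 1 / real (card (conn F `` {u})) + 1 / real (card (conn F `` {v})))
    = 2 * real (card V) * (real (card (comps V F)) - 1)"
proof -
  let ?i = "\<lambda>v. 1 / real (card (conn F `` {v}))"
  have sub: "conn F `` {u} \<subseteq> V" "conn F `` {u} \<in> comps V F" if "u \<in> V" for u
    using comps_subset[OF assms(2)] that by (auto simp: comps_image)
  have fin: "finite (separated_pairs V F)"
    by (rule finite_subset[of _ "V \<times> V"]) (use assms(1) in \<open>auto simp: separated_pairs_def\<close>)
  have S: "separated_pairs V F = Sigma V (\<lambda>u. V - conn F `` {u})" by (auto simp: separated_pairs_def)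
  have "(\<Sum>(u, v)\<in>separated_pairs V F. ?i v) = (\<Sum>u\<in>V. \<Sum>v\<in>V - conn F `` {u}. ?i v)"
    unfolding S using assms(1) by (subst sum.Sigma) auto
  also have "\<dots> = (\<Sum>u\<in>V. real (card (comps V F)) - 1)"
  proof (rule sum.cong[OF refl])
    fix u assume u: "u \<in> V"
    show "(\<Sum>v\<in>V - conn F `` {u}. ?i v) = real (card (comps V F)) - 1"
      using sum_inverse_class(1)[OF assms] sum_inverse_class(2)[OF assms sub(2)[OF u]]
        sum_diff[OF assms(1) sub(1)[OF u], of ?i] by simp
  qed
  finally have 1: "(\<Sum>(u, v)\<in>separated_pairs V F. ?i v) = card V * (real (card (comps V F)) - 1)" by simp
  have "(\<Sum>(u, v)\<in>separated_pairs V F. ?i u) = (\<Sum>(u, v)\<in>separated_pairs V F. ?i v)"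
    by (rule sum.reindex_bij_witness[of _ "\<lambda>(u, v). (v, u)" "\<lambda>(u, v). (v, u)"])
       (use conn_sym in \<open>auto simp: separated_pairs_def\<close>)
  with 1 show ?thesis by (simp add: case_prod_unfold sum.distrib)
qed

text \<open>Pitman's double counting. A forest with \<open>k\<close> components arises from one with
  \<open>k + 1\<close> components by adding an edge in \<open>card V - k\<close> ways, one for each of its edges.
  Counting in the other direction, the choices of an edge to add to a fixed forest have, by
  \<open>comp_weight_merge\<close> and \<open>sum_separated_pairs\<close>, total relative weight \<open>card V * k\<close>.\<close>

lemma rooted_forest_recursion:
  assumes "finite V"
  shows "(real (card V) - real k) * forest_sum real V k = real (card V) * real k * forest_sum real V (Suc k)"
proof -
  have fin_adj: "finite (adj F)" if "F \<in> forests V" for F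
    by (rule finite_subset[of _ "V \<times> V"])
       (use that assms(1) pairs_mem_iff in \<open>auto simp: adj_def forests_def\<close>)
  have fin_separated: "finite (separated_pairs V F)" for F
    by (rule finite_subset[of _ "V \<times> V"]) (use assms(1) in \<open>auto simp: separated_pairs_def\<close>)
  \<comment> \<open>Both sides are doubled, since edges are represented by ordered pairs of endpoints.\<close>
  have "2 * (real (card V) - real k) * forest_sum real V k = (\<Sum>F\<in>forests_with V k. \<Sum>e\<in>adj F. comp_weight real V F)"
    unfolding forest_sum_def sum_distrib_left
  proof (rule sum.cong[OF refl])
    fix F assume F: "F \<in> forests_with V k"
    then have "card F + k = card V" "card (adj F) = 2 * card F"
      using forest_card[OF assms, of F] card_adj[OF assms, of F] by (auto simp: forests_with_def forests_def)
    then have "real (card V) = real (card F) + real k" "real (card (adj F)) = 2 * real (card F)"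
      by (metis of_nat_add) (simp add: \<open>card (adj F) = 2 * card F\<close>)
    then have "real (card (adj F)) = 2 * (real (card V) - real k)" by simp
    then show "2 * (real (card V) - real k) * comp_weight real V F = (\<Sum>e\<in>adj F. comp_weight real V F)"
      by simp
  qed
  also have "\<dots> = (\<Sum>(F, e)\<in>Sigma (forests_with V k) adj. comp_weight real V F)"
    using assms fin_adj by (subst sum.Sigma) (auto simp: forests_with_def)
  also have "\<dots> = (\<Sum>(F, u, v)\<in>Sigma (forests_with V (Suc k)) (separated_pairs V). comp_weight real V (insert {u, v} F))"
  proof (rule sum.reindex_bij_witness[of _ "\<lambda>(F, u, v). (insert {u, v} F, u, v)"
        "\<lambda>(F, u, v). (F - {{u, v}}, u, v)"])
    fix x assume x: "x \<in> Sigma (forests_with V k) adj"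
    obtain F u v where xe: "x = (F, u, v)" by (cases x) auto
    have F: "F \<subseteq> pairs V" "acyc F" "card (comps V F) = k" "{u, v} \<in> F"
      using x by (auto simp: xe forests_with_def forests_def adj_def)
    have uv: "u \<noteq> v" "u \<in> V" "v \<in> V" using F pairs_mem_iff by blast+
    have ins: "insert {u, v} (F - {{u, v}}) = F" using F by auto
    show "(case case x of (F, u, v) \<Rightarrow> (F - {{u, v}}, u, v) of (F, u, v) \<Rightarrow> (insert {u, v} F, u, v)) = x"
      using ins by (simp add: xe)
    have n: "(u, v) \<notin> conn (F - {{u, v}})" using F by (auto simp: acyc_def)
    have "acyc (F - {{u, v}})" using F acyc_mono by blast
    moreover have "card (comps V (F - {{u, v}})) = Suc k"
      using card_comps_insert[OF assms uv(2,3) n] ins F by simp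
    ultimately show "(case x of (F, u, v) \<Rightarrow> (F - {{u, v}}, u, v)) \<in> Sigma (forests_with V (Suc k)) (separated_pairs V)"
      using F uv n by (auto simp: xe forests_with_def forests_def separated_pairs_def)
    show "(case case x of (F, u, v) \<Rightarrow> (F - {{u, v}}, u, v) of (F, u, v) \<Rightarrow> comp_weight real V (insert {u, v} F))
      = (case x of (F, e) \<Rightarrow> comp_weight real V F)"
      using ins by (simp add: xe)
  next
    fix x assume x: "x \<in> Sigma (forests_with V (Suc k)) (separated_pairs V)"
    obtain F u v where xe: "x = (F, u, v)" by (cases x) auto
    have F: "F \<subseteq> pairs V" "acyc F" "card (comps V F) = Suc k" "(u, v) \<notin> conn F" "u \<in> V" "v \<in> V"
      using x by (auto simp: xe forests_with_def forests_def separated_pairs_def)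
    have uv: "u \<noteq> v" "{u, v} \<notin> F" using F conn_edge by auto
    show "(case case x of (F, u, v) \<Rightarrow> (insert {u, v} F, u, v) of (F, u, v) \<Rightarrow> (F - {{u, v}}, u, v)) = x"
      using uv by (simp add: xe)
    have "acyc (insert {u, v} F)" using acyc_insert[OF uv(2)] F by simp
    moreover have "card (comps V (insert {u, v} F)) = k"
      using card_comps_insert[OF assms F(5,6,4)] F(3) by simp
    ultimately show "(case x of (F, u, v) \<Rightarrow> (insert {u, v} F, u, v)) \<in> Sigma (forests_with V k) adj"
      using F uv by (auto simp: xe forests_with_def forests_def adj_def pairs_mem_iff)
  qed
  also have "\<dots> = (\<Sum>F\<in>forests_with V (Suc k). \<Sum>(u, v)\<in>separated_pairs V F. comp_weight real V (insert {u, v} F))"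
    using assms fin_separated by (subst sum.Sigma) (auto simp: case_prod_unfold)
  also have "\<dots> = (\<Sum>F\<in>forests_with V (Suc k). comp_weight real V F * (2 * real (card V) * real k))"
  proof (rule sum.cong[OF refl])
    fix F assume F: "F \<in> forests_with V (Suc k)"
    then have F': "F \<subseteq> pairs V" by (auto simp: forests_with_def forests_def)
    have "(\<Sum>(u, v)\<in>separated_pairs V F. comp_weight real V (insert {u, v} F)) =
      (\<Sum>(u, v)\<in>separated_pairs V F. comp_weight real V F * (1 / card (conn F `` {u}) + 1 / card (conn F `` {v})))"
      using comp_weight_merge[OF assms F'] by (intro sum.cong) (auto simp: separated_pairs_def)
    also have "\<dots> = comp_weight real V F * (2 * real (card V) * (real (card (comps V F)) - 1))"
      unfolding sum_separated_pairs[OF assms F', symmetric] sum_distrib_left by (simp add: case_prod_unfold)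
    finally show "(\<Sum>(u, v)\<in>separated_pairs V F. comp_weight real V (insert {u, v} F)) =
        comp_weight real V F * (2 * real (card V) * real k)"
      using F by (simp add: forests_with_def)
  qed
  also have "\<dots> = 2 * (real (card V) * real k * forest_sum real V (Suc k))"
    by (simp add: forest_sum_def sum_distrib_left sum_distrib_right mult_ac)
  finally have "2 * ((real (card V) - real k) * forest_sum real V k)
      = 2 * (real (card V) * real k * forest_sum real V (Suc k))"
    by (simp only: mult.assoc)
  then show ?thesis by (simp only: mult_cancel_left) simp
qed

text \<open>Downward induction on the number of components \<open>card V - i\<close>, from the empty graph.\<close>

lemma rooted_forest_count_aux:
  assumes "finite V" "i < card V"
  shows "forest_sum real V (card V - i) = real ((card V - 1) choose (card V - i - 1)) * real (card V) ^ i"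
  using assms(2)
proof (induction i)
  case 0
  have "F \<in> forests_with V (card V) \<longleftrightarrow> F = {}" for F
  proof
    assume F: "F \<in> forests_with V (card V)"
    then have "card F = 0" using forest_card[OF assms(1), of F] by (auto simp: forests_with_def)
    moreover have "finite F" using F finite_forest[OF assms(1)] by (auto simp: forests_with_def)
    ultimately show "F = {}" by simp
  qed (auto simp: forests_with_def forests_def acyc_def comps_empty card_image)
  then have "forests_with V (card V) = {{}}" by auto
  moreover have "comp_weight real V {} = 1" by (auto simp: comp_weight_def comps_empty prod.reindex)
  ultimately show ?case by (simp add: forest_sum_def)
next
  case (Suc i)
  define n where "n = card V"
  define k where "k = n - Suc i"
  have k: "k \<ge> 1" "n - i = Suc k" "n = k + Suc i" using Suc.prems by (auto simp: k_def n_def)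
  have "(real n - real k) * forest_sum real V k = real n * real k * forest_sum real V (Suc k)"
    unfolding n_def by (rule rooted_forest_recursion[OF assms(1)])
  also have "forest_sum real V (Suc k) = real ((n - 1) choose k) * real n ^ i"
    using Suc k by (simp flip: n_def)
  finally have 1: "real (Suc i) * forest_sum real V k = real k * real ((n - 1) choose k) * real n ^ Suc i"
    using k by (simp add: algebra_simps)
  have "k * ((n - 1) choose k) = (n - 1) * ((n - 2) choose (k - 1))"
    using binomial_absorption[of "k - 1" "n - 1"] k by (simp add: numeral_2_eq_2)
  also have "\<dots> = Suc i * ((n - 1) choose (k - 1))"
    using binomial_absorb_comp[of "n - 1" "k - 1"] k by (simp add: numeral_2_eq_2)
  finally have "real k * real ((n - 1) choose k) = real (Suc i) * real ((n - 1) choose (k - 1))"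
    by (metis of_nat_mult)
  with 1 have "real (Suc i) * forest_sum real V k = real (Suc i) * (real ((n - 1) choose (k - 1)) * real n ^ Suc i)"
    by (metis mult.assoc)
  then have "forest_sum real V k = real ((n - 1) choose (k - 1)) * real n ^ Suc i" by simp
  then show ?case unfolding k_def n_def by simp
qed

lemma rooted_forest_count:
  assumes "finite V" "1 \<le> k" "k \<le> card V"
  shows "forest_sum real V k = real ((card V - 1) choose (k - 1)) * real (card V) ^ (card V - k)"
  using rooted_forest_count_aux[OF assms(1), of "card V - k"] assms(2,3) by simp

text \<open>A tree on \<open>n\<close> vertices has \<open>n\<close> possible roots, and there are \<open>n ^ (n - 1)\<close>
  rooted trees. For \<open>n = 1\<close> the truncated exponent \<open>n - 2 = 0\<close> is still right.\<close>

lemma cayley: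
  assumes "finite V" "V \<noteq> {}"
  shows "card (trees V) = card V ^ (card V - 2)"
proof -
  have n: "card V \<ge> 1" using assms by (simp add: Suc_le_eq card_gt_0_iff)
  have T: "forests_with V 1 = trees V"
  proof -
    have "comps V F = {V}" if F: "F \<in> forests V" "card (comps V F) = 1" for F
    proof -
      obtain C where C: "comps V F = {C}" using F(2) by (auto simp: card_1_singleton_iff)
      have "\<Union>(comps V F) = V" using F(1) by (intro Union_comps) (simp add: forests_def)
      with C show ?thesis by simp
    qed
    moreover have "card (comps V F) = 1" if "comps V F = {V}" for F using that by simp
    ultimately have "card (comps V F) = 1 \<longleftrightarrow> comps V F = {V}" if "F \<in> forests V" for F
      using that by metis
    then show ?thesis unfolding forests_with_def trees_def by (intro Collect_cong) metis
  qed
  have "real (card (trees V)) * card V = forest_sum real V 1"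
    unfolding forest_sum_def T by (simp add: comp_weight_def trees_def)
  also have "\<dots> = real (card V) ^ (card V - 1)"
    using rooted_forest_count[OF assms(1), of 1] n by simp
  finally have 1: "real (card (trees V)) * card V = real (card V) ^ (card V - 1)" .
  show ?thesis
  proof (cases "card V = 1")
    case False
    then have "card V - 1 = Suc (card V - 2)" using n by simp
    then have "real (card V) ^ (card V - 1) = real (card V ^ (card V - 2)) * card V" by simp
    then have "real (card (trees V)) = real (card V ^ (card V - 2))"
      using 1 n by (metis mult_right_cancel not_one_le_zero of_nat_eq_0_iff)
    then show ?thesis by linarith
  qed (use 1 in simp)
qed

section \<open>The exponential formula\<close>

lemma forests_union:
  assumes "T \<in> forests C" "F \<in> forests D" "C \<inter> D = {}"
  shows "T \<union> F \<in> forests (C \<union> D)" "comps (C \<union> D) (T \<union> F) = comps C T \<union> comps D F"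
proof -
  have p: "T \<subseteq> pairs C" "F \<subseteq> pairs D" "acyc T" "acyc F" using assms by (auto simp: forests_def)
  have "T \<union> F \<subseteq> pairs (C \<union> D)" using p(1,2) by (auto simp: pairs_def)
  then show "T \<union> F \<in> forests (C \<union> D)"
    using acyc_union[OF p(1,2) assms(3) p(3,4)] by (simp add: forests_def)
  show "comps (C \<union> D) (T \<union> F) = comps C T \<union> comps D F"
    by (rule comps_union[OF p(1,2) assms(3)])
qed

lemma forests_split:
  assumes F: "F \<in> forests V" and C: "C \<in> comps V F"
  shows "F = {e \<in> F. e \<subseteq> C} \<union> {e \<in> F. e \<subseteq> V - C}"
    and "{e \<in> F. e \<subseteq> C} \<in> trees C"
    and "{e \<in> F. e \<subseteq> V - C} \<in> forests (V - C)"
    and "comps V F = insert C (comps (V - C) {e \<in> F. e \<subseteq> V - C})"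
    and "C \<notin> comps (V - C) {e \<in> F. e \<subseteq> V - C}"
proof -
  let ?T = "{e \<in> F. e \<subseteq> C}" and ?F = "{e \<in> F. e \<subseteq> V - C}"
  have p: "F \<subseteq> pairs V" "acyc F" using F by (auto simp: forests_def)
  have CV: "C \<subseteq> V" "C \<noteq> {}" using comps_subset[OF p(1) C] comps_nonempty[OF C] by auto
  show eq: "F = ?T \<union> ?F"
  proof (rule set_eqI, rule iffI)
    fix e assume e: "e \<in> F"
    then obtain u v where uv: "e = {u, v}" "u \<in> V" "v \<in> V" using pairsE[OF subsetD[OF p(1) e]] by metis
    have c: "(u, v) \<in> conn F" using conn_edge e uv by auto
    show "e \<in> ?T \<union> ?F"
    proof (cases "u \<in> C")
      case True
      then have "v \<in> C" using comp_eq_class[OF C True] c by auto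
      then show ?thesis using True e uv by auto
    next
      case False
      have "v \<notin> C" using comp_eq_class[OF C, of v] conn_sym[OF c] False by auto
      then show ?thesis using False e uv by auto
    qed
  qed auto
  have pT: "?T \<subseteq> pairs C" and pF: "?F \<subseteq> pairs (V - C)" using p(1) by (auto simp: pairs_def)
  have aT: "acyc ?T" and aF: "acyc ?F" using p(2) by (auto intro: acyc_mono)
  show F2: "?F \<in> forests (V - C)" using pF aF by (simp add: forests_def)
  have d: "C \<inter> (V - C) = {}" "C \<union> (V - C) = V" using CV by auto
  have cls: "conn ?T `` {x} = C" if x: "x \<in> C" for x
  proof -
    have "conn ?T `` {x} = conn F `` {x}"
      using conn_union_left[OF pT pF d(1) x] eq by auto
    then show ?thesis using comp_eq_class[OF C x] by simp
  qed
  then have cT: "comps C ?T = {C}" unfolding comps_image using CV(2) by (auto simp: image_constant_conv)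
  then show "?T \<in> trees C" using pT aT by (simp add: trees_def forests_def)
  show "comps V F = insert C (comps (V - C) ?F)"
    using comps_union[OF pT pF d(1)] cT eq d(2) by simp
  show "C \<notin> comps (V - C) ?F" using comps_subset[OF pF, of C] CV by auto
qed

text \<open>A forest with a distinguished component \<open>C\<close> is the same as a tree on \<open>C\<close> together
  with a forest on the remaining vertices.\<close>

lemma mark_component:
  assumes "finite V"
  shows "real (Suc m) * forest_sum g V (Suc m)
    = (\<Sum>C\<in>Pow V - {{}}. g (card C) * real (card (trees C)) * forest_sum g (V - C) m)"
proof -
  let ?S = "Sigma (Pow V - {{}}) (\<lambda>C. trees C \<times> forests_with (V - C) m)"
  have ft: "finite (trees C)" if "C \<subseteq> V" for C
    using finite_subset[OF that assms] by (simp add: trees_def)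
  have "real (Suc m) * forest_sum g V (Suc m) = (\<Sum>F\<in>forests_with V (Suc m). \<Sum>C\<in>comps V F. comp_weight g V F)"
    unfolding forest_sum_def sum_distrib_left by (rule sum.cong) (auto simp: forests_with_def)
  also have "\<dots> = (\<Sum>(F, C)\<in>Sigma (forests_with V (Suc m)) (comps V). comp_weight g V F)"
    using assms by (subst sum.Sigma) auto
  also have "\<dots> = (\<Sum>(C, T, F)\<in>?S. g (card C) * comp_weight g (V - C) F)"
  proof (rule sum.reindex_bij_witness[of _ "\<lambda>(C, T, F). (T \<union> F, C)"
        "\<lambda>(F, C). (C, {e \<in> F. e \<subseteq> C}, {e \<in> F. e \<subseteq> V - C})"])
    fix x assume x: "x \<in> Sigma (forests_with V (Suc m)) (comps V)"
    obtain F C where xe: "x = (F, C)" by (cases x) auto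
    have F: "F \<in> forests V" "card (comps V F) = Suc m" and C: "C \<in> comps V F"
      using x by (auto simp: xe forests_with_def)
    note sp = forests_split[OF F(1) C]
    show "(case case x of (F, C) \<Rightarrow> (C, {e \<in> F. e \<subseteq> C}, {e \<in> F. e \<subseteq> V - C}) of
         (C, T, F) \<Rightarrow> (T \<union> F, C)) = x"
      using sp(1) by (simp add: xe)
    have fin: "finite (comps (V - C) {e \<in> F. e \<subseteq> V - C})" using assms by simp
    have "C \<subseteq> V" "C \<noteq> {}" using comps_subset[OF _ C] comps_nonempty[OF C] F by (auto simp: forests_def)
    moreover have "card (comps (V - C) {e \<in> F. e \<subseteq> V - C}) = m"
      using F(2) fin sp(5) unfolding sp(4) by simp
    ultimately show "(case x of (F, C) \<Rightarrow> (C, {e \<in> F. e \<subseteq> C}, {e \<in> F. e \<subseteq> V - C})) \<in> ?S"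
      using sp by (auto simp: xe forests_with_def)
    have "comp_weight g V F = g (card C) * comp_weight g (V - C) {e \<in> F. e \<subseteq> V - C}"
      unfolding comp_weight_def sp(4) by (rule prod.insert[OF fin sp(5)])
    then show "(case case x of (F, C) \<Rightarrow> (C, {e \<in> F. e \<subseteq> C}, {e \<in> F. e \<subseteq> V - C}) of
         (C, T, F) \<Rightarrow> g (card C) * comp_weight g (V - C) F) = (case x of (F, C) \<Rightarrow> comp_weight g V F)"
      by (simp add: xe)
  next
    fix x assume x: "x \<in> ?S"
    obtain C T F where xe: "x = (C, T, F)" by (cases x) auto
    have CV: "C \<subseteq> V" "C \<noteq> {}" and T: "T \<in> forests C" "comps C T = {C}"
      and F: "F \<in> forests (V - C)" "card (comps (V - C) F) = m"
      using x by (auto simp: xe forests_with_def trees_def)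
    have d: "C \<inter> (V - C) = {}" "C \<union> (V - C) = V" using CV by auto
    note u = forests_union[OF T(1) F(1) d(1), unfolded d(2)]
    have pF: "F \<subseteq> pairs (V - C)" "T \<subseteq> pairs C" using F T by (auto simp: forests_def)
    have "{e \<in> T \<union> F. e \<subseteq> C} = T" "{e \<in> T \<union> F. e \<subseteq> V - C} = F"
    proof -
      have a: "e \<subseteq> C \<and> \<not> e \<subseteq> V - C" if eT: "e \<in> T" for e
      proof -
        obtain u v where "e = {u, v}" "u \<in> C" "v \<in> C" using pairsE[OF subsetD[OF pF(2) eT]] by metis
        then show ?thesis by auto
      qed
      have b: "e \<subseteq> V - C \<and> \<not> e \<subseteq> C" if eF: "e \<in> F" for e
      proof -
        obtain u v where "e = {u, v}" "u \<in> V - C" "v \<in> V - C" using pairsE[OF subsetD[OF pF(1) eF]] by metis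
        then show ?thesis by auto
      qed
      show "{e \<in> T \<union> F. e \<subseteq> C} = T" "{e \<in> T \<union> F. e \<subseteq> V - C} = F"
        by (intro set_eqI iffI; use a b in \<open>fast | simp\<close>)+
    qed
    then show "(case case x of (C, T, F) \<Rightarrow> (T \<union> F, C) of (F, C) \<Rightarrow> (C, {e \<in> F. e \<subseteq> C}, {e \<in> F. e \<subseteq> V - C})) = x"
      by (simp add: xe)
    have "C \<notin> comps (V - C) F" using comps_subset[OF pF(1), of C] CV by auto
    then have "card (comps V (T \<union> F)) = Suc m" using u(2) T(2) F(2) assms by simp
    then show "(case x of (C, T, F) \<Rightarrow> (T \<union> F, C)) \<in> Sigma (forests_with V (Suc m)) (comps V)"
      using u T by (auto simp: xe forests_with_def)
  qed
  also have "\<dots> = (\<Sum>C\<in>Pow V - {{}}. \<Sum>(T, F)\<in>trees C \<times> forests_with (V - C) m. g (card C) * comp_weight g (V - C) F)"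
    using assms ft by (subst sum.Sigma) auto
  also have "\<dots> = (\<Sum>C\<in>Pow V - {{}}. g (card C) * real (card (trees C)) * forest_sum g (V - C) m)"
    unfolding sum.cartesian_product[symmetric] forest_sum_def
    by (intro sum.cong refl) (simp add: sum_distrib_left[symmetric] mult_ac)
  finally show ?thesis .
qed

lemma sum_Pow_card:
  fixes h :: "nat \<Rightarrow> real"
  assumes "finite V"
  shows "(\<Sum>C\<in>Pow V. h (card C)) = (\<Sum>j\<le>card V. real (card V choose j) * h j)"
proof -
  have "(\<Sum>C\<in>Pow V. h (card C)) = (\<Sum>j\<in>{..card V}. \<Sum>C\<in>{C \<in> Pow V. card C = j}. h (card C))"
    by (rule sum.group[symmetric]) (use assms card_mono in auto)
  also have "\<dots> = (\<Sum>j\<le>card V. real (card V choose j) * h j)"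
    using n_subsets[OF assms] by (intro sum.cong) auto
  finally show ?thesis .
qed

text \<open>The exponential generating function of labelled trees, each tree on \<open>k\<close> vertices being
  counted with weight \<open>g k\<close>.\<close>

definition tree_fps :: "(nat \<Rightarrow> real) \<Rightarrow> real fps" where
  "tree_fps g = Abs_fps (\<lambda>k. if k = 0 then 0 else g k * real k ^ (k - 2) / fact k)"

lemma tree_fps_nth: "fps_nth (tree_fps g) k = (if k = 0 then 0 else g k * real k ^ (k - 2) / fact k)"
  by (simp add: tree_fps_def)

text \<open>The recursion of \<open>mark_component\<close> is, after division by \<open>fact (card V)\<close>, the
  recursion for the coefficients of the powers of a power series. In particular the left-hand side
  depends on \<open>V\<close> only through its cardinality.\<close>

lemma forest_sum_eq_fps:
  assumes "finite V"
  shows "forest_sum g V m = fact (card V) / fact m * fps_nth (tree_fps g ^ m) (card V)"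
  using assms
proof (induction m arbitrary: V)
  case 0
  have "forests_with V 0 = (if V = {} then {{}} else {})"
  proof -
    have "V = {}" if F: "F \<in> forests_with V 0" for F
    proof -
      have "comps V F = {}" "F \<subseteq> pairs V" using F 0 by (auto simp: forests_with_def forests_def)
      then show ?thesis using Union_comps[of F V] by simp
    qed
    moreover have "F = {}" if "F \<in> forests_with {} 0" for F
      using that by (auto simp: forests_with_def forests_def pairs_def)
    moreover have "{} \<in> forests_with {} 0" by (auto simp: forests_with_def forests_def acyc_def comps_empty)
    ultimately show ?thesis by auto
  qed
  then show ?case using 0 by (auto simp: forest_sum_def comp_weight_def comps_empty)
next
  case (Suc m)
  let ?n = "card V" and ?A = "tree_fps g"
  define h where "h j = (if j = 0 then 0 else g j * real j ^ (j - 2) * (fact (?n - j) / fact m * fps_nth (?A ^ m) (?n - j)))" for j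
  have "real (Suc m) * forest_sum g V (Suc m) = (\<Sum>C\<in>Pow V - {{}}. h (card C))"
    unfolding mark_component[OF Suc.prems]
  proof (rule sum.cong[OF refl])
    fix C assume C: "C \<in> Pow V - {{}}"
    then have f: "finite C" using Suc.prems finite_subset by auto
    have "card (V - C) = ?n - card C" using C f by (simp add: card_Diff_subset)
    moreover have "card C \<noteq> 0" using f C by auto
    ultimately show "g (card C) * real (card (trees C)) * forest_sum g (V - C) m = h (card C)"
      using Suc.IH[of "V - C"] Suc.prems C cayley[OF f] by (simp add: h_def)
  qed
  also have "\<dots> = (\<Sum>C\<in>Pow V. h (card C))"
    by (rule sum.mono_neutral_left) (use Suc.prems in \<open>auto simp: h_def\<close>)
  also have "\<dots> = (\<Sum>j\<le>?n. real (?n choose j) * h j)" by (rule sum_Pow_card[OF Suc.prems])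
  also have "\<dots> = (\<Sum>j\<le>?n. fact ?n / fact m * (fps_nth ?A j * fps_nth (?A ^ m) (?n - j)))"
  proof (rule sum.cong[OF refl])
    fix j assume "j \<in> {..?n}"
    then have "real (?n choose j) = fact ?n / (fact j * fact (?n - j))" by (simp add: binomial_fact)
    then show "real (?n choose j) * h j = fact ?n / fact m * (fps_nth ?A j * fps_nth (?A ^ m) (?n - j))"
      by (simp add: h_def tree_fps_nth mult_ac)
  qed
  also have "\<dots> = fact ?n / fact m * fps_nth (?A ^ Suc m) ?n"
    by (simp add: sum_distrib_left fps_mult_nth atLeast0AtMost)
  finally have A: "real (Suc m) * forest_sum g V (Suc m) = fact ?n / fact m * fps_nth (?A ^ Suc m) ?n" .
  have "forest_sum g V (Suc m) = (fact ?n / fact m * fps_nth (?A ^ Suc m) ?n) / real (Suc m)"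
    by (subst A[symmetric], rule nonzero_mult_div_cancel_left[symmetric]) simp
  then show ?case unfolding fact_Suc by (simp add: divide_divide_eq_left mult_ac del: power_Suc of_nat_Suc)
qed

section \<open>Tree series at the radius of convergence\<close>

lemma power_self_le_exp_fact: "real k ^ k \<le> exp (real k) * fact k"
proof -
  have s: "(\<lambda>n. real k ^ n /\<^sub>R fact n) sums exp (real k)" by (rule exp_converges)
  have "(\<Sum>n\<in>{k}. real k ^ n /\<^sub>R fact n) \<le> (\<Sum>n. real k ^ n /\<^sub>R fact n)"
    by (rule sum_le_suminf) (use s in \<open>auto simp: sums_iff\<close>)
  then have "real k ^ k / fact k \<le> exp (real k)" using s by (simp add: sums_iff divide_inverse mult.commute)
  then show ?thesis by (simp add: field_simps)
qed

text \<open>A crude form of Stirling's formula: polynomial factors are irrelevant for exponential growth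
  rates. The induction step is \<open>exp 1 \<le> (1 + 1 / k) ^ (k + 1)\<close>.\<close>

lemma fact_le_exp_power:
  assumes "k \<ge> 1"
  shows "fact k \<le> exp 1 * real k ^ Suc k * exp (- real k)"
  using assms
proof (induction k rule: dec_induct)
  case base
  show ?case by (simp flip: exp_add)
next
  case (step k)
  let ?k = "real k"
  have k: "?k \<ge> 1" using step.hyps by simp
  have "1 / (?k + 1) \<le> ln ((?k + 1) / ?k)"
  proof -
    have "ln (?k / (?k + 1)) \<le> ?k / (?k + 1) - 1" using k by (intro ln_le_minus_one) auto
    also have "\<dots> = - (1 / (?k + 1))" using k by (simp add: field_simps)
    finally show ?thesis using k by (simp add: ln_div)
  qed
  then have "1 \<le> real (Suc k) * ln ((?k + 1) / ?k)" using k by (simp add: field_simps)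
  then have "exp 1 \<le> exp (real (Suc k) * ln ((?k + 1) / ?k))" by (simp only: exp_le_cancel_iff)
  also have "\<dots> = ((?k + 1) / ?k) ^ Suc k"
    using k by (subst exp_of_nat_mult) (simp)
  finally have e: "exp 1 * ?k ^ Suc k \<le> (?k + 1) ^ Suc k"
    using k by (simp add: power_divide field_simps)
  have "fact (Suc k) = (?k + 1) * fact k" by simp
  also have "\<dots> \<le> (?k + 1) * (exp 1 * ?k ^ Suc k * exp (- ?k))"
    using step.IH k by (intro mult_left_mono) auto
  also have "\<dots> \<le> (?k + 1) * ((?k + 1) ^ Suc k * exp (- ?k))"
    using e k by (intro mult_left_mono mult_right_mono) auto
  also have "\<dots> = exp 1 * real (Suc k) ^ Suc (Suc k) * exp (- real (Suc k))"
  proof -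
    have "exp (- ?k) = exp 1 * exp (- real (Suc k))" by (simp flip: exp_add)
    moreover have "?k + 1 = real (Suc k)" by simp
    ultimately show ?thesis by (simp only: power_Suc mult_ac)
  qed
  finally show ?case .
qed

abbreviation "rooted_fps \<equiv> tree_fps real"
abbreviation "unrooted_fps \<equiv> tree_fps (\<lambda>_. 1)"

lemma fps_nth_mult_self_power:
  "fps_nth (a * b) n * w ^ n = (\<Sum>i\<le>n. (fps_nth a i * w ^ i) * (fps_nth b (n - i) * w ^ (n - i)))"
  for w :: real
  unfolding fps_mult_nth sum_distrib_right atLeast0AtMost
  by (intro sum.cong refl) (simp flip: power_add add: mult_ac)

lemma rooted_nth: "fps_nth rooted_fps k = real k * fps_nth unrooted_fps k"
  by (simp add: tree_fps_nth)

lemma rooted_eq_deriv: "rooted_fps = fps_X * fps_deriv unrooted_fps"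
proof (rule fps_ext)
  fix n show "fps_nth rooted_fps n = fps_nth (fps_X * fps_deriv unrooted_fps) n"
    by (cases n) (simp_all add: rooted_nth)
qed

text \<open>A tree has one more vertex than edges, and marking an edge cuts the tree into an unordered
  pair of rooted trees. The proof reads the identity off the two expressions for the number of
  rooted forests with two components.\<close>

lemma rooted_minus_unrooted: "rooted_fps - unrooted_fps = fps_const (1/2) * rooted_fps ^ 2"
proof (rule fps_ext)
  fix n
  have "forest_sum real {..<n} 2 = fact n / 2 * fps_nth (rooted_fps ^ 2) n"
    using forest_sum_eq_fps[of "{..<n}" real 2] by (simp add: fact_2)
  moreover have "forest_sum real {..<n} 2 = (real n - 1) * real n ^ (n - 2)" if "n \<ge> 2"
    using rooted_forest_count[of "{..<n}" 2] that by (simp add: of_nat_diff)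
  moreover have "fps_nth (rooted_fps ^ 2) n = 0" if "n < 2"
    using startsby_zero_power_prefix[of rooted_fps 2] that by (simp add: tree_fps_nth)
  moreover have "n = 0 \<or> n = 1 \<or> n \<ge> 2" by auto
  ultimately show "fps_nth (rooted_fps - unrooted_fps) n = fps_nth (fps_const (1/2) * rooted_fps ^ 2) n"
    by (auto simp: tree_fps_nth field_simps)
qed

lemma rooted_deriv: "fps_X * fps_deriv rooted_fps = rooted_fps + fps_X * fps_deriv rooted_fps * rooted_fps"
proof -
  have "fps_deriv (rooted_fps - unrooted_fps) = fps_const (1/2) * (2 * rooted_fps * fps_deriv rooted_fps)"
    unfolding rooted_minus_unrooted by (simp add: power2_eq_square)
  also have "\<dots> = rooted_fps * fps_deriv rooted_fps"
    by (simp add: mult.assoc[symmetric] flip: numeral_fps_const)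
  finally have "fps_X * fps_deriv (rooted_fps - unrooted_fps) = fps_X * (rooted_fps * fps_deriv rooted_fps)"
    by simp
  then have "fps_X * fps_deriv rooted_fps - rooted_fps = fps_X * (rooted_fps * fps_deriv rooted_fps)"
    by (simp add: right_diff_distrib rooted_eq_deriv[symmetric])
  then have "fps_X * fps_deriv rooted_fps = rooted_fps + fps_X * (rooted_fps * fps_deriv rooted_fps)"
    by (metis add.commute diff_add_cancel)
  also have "fps_X * (rooted_fps * fps_deriv rooted_fps) = fps_X * fps_deriv rooted_fps * rooted_fps"
    by (simp only: mult_ac)
  finally show ?thesis .
qed

text \<open>Coefficients of the series of rooted, doubly rooted and unrooted trees. The powers
  \<open>k ^ (k - 1)\<close>, \<open>k ^ k\<close> and \<open>k ^ (k - 2)\<close>, divided by \<open>fact k\<close>,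
  give their common radius of convergence \<open>exp (- 1)\<close>.\<close>

definition "rooted_coeff k = fps_nth rooted_fps k"
definition "birooted_coeff k = real k * fps_nth rooted_fps k"
definition "tree_coeff k = fps_nth unrooted_fps k"

lemma tree_coeffs_nonneg: "rooted_coeff k \<ge> 0" "birooted_coeff k \<ge> 0" "tree_coeff k \<ge> 0"
  by (auto simp: rooted_coeff_def birooted_coeff_def tree_coeff_def tree_fps_nth)

lemma birooted_coeff_eq: "birooted_coeff k = rooted_coeff k + (\<Sum>i\<le>k. birooted_coeff i * rooted_coeff (k - i))"
proof -
  have d: "fps_nth (fps_X * fps_deriv rooted_fps) n = birooted_coeff n" for n
    by (cases n) (simp_all add: birooted_coeff_def)
  show ?thesis
    using arg_cong[OF rooted_deriv, of "\<lambda>f. fps_nth f k"] unfolding fps_add_nth fps_mult_nth[of "fps_X * _"] d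
    by (simp add: rooted_coeff_def atLeast0AtMost)
qed

lemma tree_coeff_eq: "tree_coeff k = rooted_coeff k - (\<Sum>i\<le>k. rooted_coeff i * rooted_coeff (k - i)) / 2"
  using arg_cong[OF rooted_minus_unrooted, of "\<lambda>f. fps_nth f k"]
  unfolding fps_mult_left_const_nth
  by (simp add: rooted_coeff_def tree_coeff_def power2_eq_square fps_mult_nth atLeast0AtMost)

lemma birooted_coeff_nth: "k \<ge> 1 \<Longrightarrow> birooted_coeff k = real k ^ k / fact k"
proof -
  assume "k \<ge> 1"
  then consider "k = 1" | m where "k = Suc (Suc m)" by (metis One_nat_def not0_implies_Suc not_one_le_zero)
  then show ?thesis by cases (auto simp: birooted_coeff_def tree_fps_nth power_Suc2 mult_ac)
qed

lemma birooted_coeff_le: "birooted_coeff k \<le> exp 1 ^ k"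
proof (cases "k = 0")
  case False
  then show ?thesis using power_self_le_exp_fact[of k] by (simp add: birooted_coeff_nth field_simps flip: exp_of_nat_mult)
qed (simp add: birooted_coeff_def)

lemma rooted_coeff_le_birooted_coeff: "rooted_coeff k \<le> birooted_coeff k"
proof (cases "k = 0")
  case False
  then have "1 * rooted_coeff k \<le> real k * rooted_coeff k" by (intro mult_right_mono tree_coeffs_nonneg) auto
  then show ?thesis by (simp add: birooted_coeff_def rooted_coeff_def)
qed (simp add: birooted_coeff_def rooted_coeff_def tree_fps_nth)

text \<open>Inside the disc of convergence the identity \<open>birooted_coeff_eq\<close> says \<open>D = R + D * R\<close> for the
  values \<open>D\<close>, \<open>R\<close> of the two series, hence \<open>R = D / (1 + D) < 1\<close>.\<close>

lemma rooted_coeff_partial_sum_inside: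
  assumes w: "0 < w" "w < exp (- 1)"
  shows "(\<Sum>k<N. rooted_coeff k * w ^ k) \<le> 1"
proof -
  let ?d = "\<lambda>k. birooted_coeff k * w ^ k" and ?r = "\<lambda>k. rooted_coeff k * w ^ k"
  have "exp 1 * w < 1" using w by (simp add: exp_minus field_simps)
  then have g: "summable (\<lambda>k. (exp 1 * w) ^ k)" using w by (intro summable_geometric) auto
  have sd: "summable ?d"
    by (rule summable_comparison_test'[OF g, of 0])
       (use w tree_coeffs_nonneg birooted_coeff_le in \<open>auto simp: power_mult_distrib abs_mult intro!: mult_right_mono\<close>)
  have sr: "summable ?r"
    by (rule summable_comparison_test'[OF sd, of 0])
       (use w tree_coeffs_nonneg rooted_coeff_le_birooted_coeff in \<open>auto simp: abs_mult intro!: mult_right_mono\<close>)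
  have "(\<lambda>k. \<Sum>i\<le>k. ?d i * ?r (k - i)) sums (suminf ?d * suminf ?r)"
    by (rule Cauchy_product_sums) (use sd sr w tree_coeffs_nonneg in \<open>auto simp: abs_mult\<close>)
  moreover have "(\<Sum>i\<le>k. ?d i * ?r (k - i)) = ?d k - ?r k" for k
  proof -
    have "(\<Sum>i\<le>k. ?d i * ?r (k - i)) = (\<Sum>i\<le>k. birooted_coeff i * rooted_coeff (k - i)) * w ^ k"
      unfolding sum_distrib_right by (intro sum.cong refl) (simp flip: power_add add: mult_ac)
    then show ?thesis using birooted_coeff_eq[of k] by (simp add: algebra_simps)
  qed
  moreover have "(\<lambda>k. ?d k - ?r k) sums (suminf ?d - suminf ?r)"
    using sd sr by (intro sums_diff summable_sums)
  ultimately have eq: "suminf ?d - suminf ?r = suminf ?d * suminf ?r" using sums_unique2 by auto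
  have d0: "suminf ?d \<ge> 0" using sd w tree_coeffs_nonneg by (intro suminf_nonneg) auto
  have "suminf ?r = suminf ?d / (1 + suminf ?d)" using eq d0 by (simp add: field_simps)
  moreover have "suminf ?d / (1 + suminf ?d) \<le> 1" using d0 by simp
  ultimately have "suminf ?r \<le> 1" by linarith
  moreover have "(\<Sum>k<N. ?r k) \<le> suminf ?r"
    by (rule sum_le_suminf[OF sr]) (use w tree_coeffs_nonneg in auto)
  ultimately show ?thesis by linarith
qed

lemma rooted_coeff_partial_sum: "(\<Sum>k<N. rooted_coeff k * exp (- 1) ^ k) \<le> 1"
proof -
  have "((\<lambda>w. \<Sum>k<N. rooted_coeff k * w ^ k) \<longlongrightarrow> (\<Sum>k<N. rooted_coeff k * exp (- 1) ^ k)) (at_left (exp (- 1)))"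
    by (intro tendsto_intros)
  moreover have "eventually (\<lambda>w. w \<in> {0<..<exp (- 1)}) (at_left (exp (- 1) :: real))"
    by (rule eventually_at_left_real) simp
  then have "eventually (\<lambda>w. (\<Sum>k<N. rooted_coeff k * w ^ k) \<le> 1) (at_left (exp (- 1) :: real))"
    by eventually_elim (use rooted_coeff_partial_sum_inside in auto)
  ultimately show ?thesis
    by (rule tendsto_upperbound) simp
qed

text \<open>The sum is at most \<open>1\<close> by \<open>rooted_coeff_partial_sum\<close>. If it were smaller, the truncated
  form of \<open>D (1 - R) = R\<close> would bound the partial sums of the doubly rooted series; these
  diverge like the harmonic series or faster.\<close>

lemma rooted_coeff_sums: "(\<lambda>k. rooted_coeff k * exp (- 1) ^ k) sums 1"
proof -
  let ?d = "\<lambda>k. birooted_coeff k * exp (- 1) ^ k" and ?r = "\<lambda>k. rooted_coeff k * exp (- 1) ^ k :: real"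
  have sr: "summable ?r"
    by (rule summableI_nonneg_bounded[where x = 1]) (use rooted_coeff_partial_sum tree_coeffs_nonneg in auto)
  have le: "suminf ?r \<le> 1" by (rule suminf_le_const[OF sr rooted_coeff_partial_sum])
  have "suminf ?r \<ge> 1"
  proof (rule ccontr)
    assume "\<not> suminf ?r \<ge> 1"
    then have lt: "1 - suminf ?r > 0" by simp
    have bound: "(\<Sum>k<N. ?d k) \<le> 1 / (1 - suminf ?r)" for N
    proof -
      have "(\<Sum>k<N. ?d k) - (\<Sum>k<N. ?r k) = (\<Sum>k<N. \<Sum>i\<le>k. ?d i * ?r (k - i))"
        unfolding sum_subtractf[symmetric]
      proof (rule sum.cong[OF refl])
        fix k
        have "(\<Sum>i\<le>k. ?d i * ?r (k - i)) = (\<Sum>i\<le>k. birooted_coeff i * rooted_coeff (k - i)) * exp (- 1) ^ k"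
          unfolding sum_distrib_right by (intro sum.cong refl) (simp flip: power_add add: mult_ac)
        then show "?d k - ?r k = (\<Sum>i\<le>k. ?d i * ?r (k - i))" using birooted_coeff_eq[of k] by (simp add: algebra_simps)
      qed
      also have "\<dots> = (\<Sum>(i, j)\<in>{(i, j). i + j < N}. ?d i * ?r j)"
        by (rule sum.triangle_reindex[symmetric])
      also have "\<dots> \<le> (\<Sum>(i, j)\<in>{..<N} \<times> {..<N}. ?d i * ?r j)"
        by (rule sum_mono2) (use tree_coeffs_nonneg in auto)
      also have "\<dots> = (\<Sum>k<N. ?d k) * (\<Sum>k<N. ?r k)"
        by (simp add: sum_product sum.cartesian_product)
      also have "\<dots> \<le> (\<Sum>k<N. ?d k) * suminf ?r"
        by (intro mult_left_mono sum_le_suminf[OF sr] sum_nonneg) (use tree_coeffs_nonneg in auto)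
      finally have "(\<Sum>k<N. ?d k) * (1 - suminf ?r) \<le> (\<Sum>k<N. ?r k)" by (simp add: algebra_simps)
      also have "\<dots> \<le> 1" by (rule rooted_coeff_partial_sum)
      finally show ?thesis using lt by (simp add: field_simps)
    qed
    have sd: "summable ?d"
      by (rule summableI_nonneg_bounded[OF _ bound]) (use tree_coeffs_nonneg in auto)
    have "summable (\<lambda>k. exp 1 * ?d k)" by (rule summable_mult[OF sd])
    moreover have "norm (inverse (real k)) \<le> exp 1 * ?d k" if "k \<ge> 1" for k
    proof -
      have "fact k \<le> exp 1 * real k ^ Suc k * exp (- real k)" by (rule fact_le_exp_power[OF that])
      also have "exp (- real k) = exp (- 1) ^ k" by (simp flip: exp_of_nat_mult)
      finally have "1 \<le> real k * (exp 1 * (real k ^ k / fact k * exp (- 1) ^ k))"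
        by (simp add: field_simps)
      then show ?thesis using that by (simp add: birooted_coeff_nth field_simps)
    qed
    ultimately have "summable (\<lambda>k. inverse (real k))" by (rule summable_comparison_test')
    then show False using not_summable_harmonic[where 'a = real] by simp
  qed
  with le have "suminf ?r = 1" by simp
  then show ?thesis using sr by (simp add: sums_iff)
qed

text \<open>With \<open>R = 1\<close>, the unrooted series has the value \<open>R - R\<^sup>2 / 2 = 1 / 2\<close>. This is
  the constant in the term \<open>1 / (2 * x)\<close> of the limit in the supercritical regime.\<close>

lemma tree_coeff_sums: "(\<lambda>k. tree_coeff k * exp (- 1) ^ k) sums (1 / 2)"
proof -
  let ?r = "\<lambda>k. rooted_coeff k * exp (- 1) ^ k :: real"
  have 1: "suminf ?r = 1" "summable ?r" using rooted_coeff_sums by (simp_all add: sums_iff)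
  have "(\<lambda>k. \<Sum>i\<le>k. ?r i * ?r (k - i)) sums (suminf ?r * suminf ?r)"
    by (rule Cauchy_product_sums) (use 1 tree_coeffs_nonneg in \<open>auto simp: abs_mult\<close>)
  moreover have "(\<Sum>i\<le>k. ?r i * ?r (k - i)) = 2 * (?r k - tree_coeff k * exp (- 1) ^ k)" for k
  proof -
    have "(\<Sum>i\<le>k. ?r i * ?r (k - i)) = (\<Sum>i\<le>k. rooted_coeff i * rooted_coeff (k - i)) * exp (- 1) ^ k"
      unfolding sum_distrib_right by (intro sum.cong refl) (simp flip: power_add add: mult_ac)
    then show ?thesis unfolding tree_coeff_eq[of k] by (simp add: algebra_simps)
  qed
  ultimately have "(\<lambda>k. 2 * (?r k - tree_coeff k * exp (- 1) ^ k)) sums 1" using 1 by simp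
  then have "(\<lambda>k. (2 * (?r k - tree_coeff k * exp (- 1) ^ k)) / 2) sums (1 / 2)" by (rule sums_divide)
  then have "(\<lambda>k. ?r k - (2 * (?r k - tree_coeff k * exp (- 1) ^ k)) / 2) sums (1 - 1 / 2)"
    by (rule sums_diff[OF rooted_coeff_sums])
  then show ?thesis by (simp add: diff_divide_distrib)
qed

section \<open>Bounds on the number of forests\<close>

text \<open>The exponential generating function of forests, counted with a factor \<open>c\<close> for each
  component and \<open>g k\<close> for each component of size \<open>k\<close>.\<close>

definition forest_fps :: "(nat \<Rightarrow> real) \<Rightarrow> real \<Rightarrow> real fps" where
  "forest_fps g c = fps_compose (fps_exp c) (tree_fps g)"

lemma tree_fps_0 [simp]: "fps_nth (tree_fps g) 0 = 0"
  by (simp add: tree_fps_nth)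

lemma tree_fps_power_low: "n < m \<Longrightarrow> fps_nth (tree_fps g ^ m) n = 0"
  using startsby_zero_power_prefix[of "tree_fps g" m] by simp

lemma forest_fps_nth:
  assumes "n \<le> L"
  shows "fps_nth (forest_fps g c) n = (\<Sum>m\<le>L. c ^ m / fact m * fps_nth (tree_fps g ^ m) n)"
proof -
  have "fps_nth (forest_fps g c) n = (\<Sum>m\<le>n. c ^ m / fact m * fps_nth (tree_fps g ^ m) n)"
    by (simp add: forest_fps_def fps_compose_nth atLeast0AtMost)
  also have "\<dots> = (\<Sum>m\<le>L. c ^ m / fact m * fps_nth (tree_fps g ^ m) n)"
    by (rule sum.mono_neutral_left) (use assms tree_fps_power_low in auto)
  finally show ?thesis .
qed

lemma fps_power_nonneg:
  fixes A :: "real fps"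
  assumes "\<And>n. fps_nth A n \<ge> 0"
  shows "fps_nth (A ^ m) n \<ge> 0"
proof (induction m arbitrary: n)
  case (Suc m)
  then show ?case using assms by (auto simp: fps_mult_nth intro!: sum_nonneg)
qed auto

lemma tree_fps_power_nonneg: "(\<And>k. g k \<ge> 0) \<Longrightarrow> fps_nth (tree_fps g ^ m) n \<ge> 0"
  by (rule fps_power_nonneg) (auto simp: tree_fps_nth)

lemma forest_fps_nonneg:
  assumes "\<And>k. g k \<ge> 0" "c \<ge> 0"
  shows "fps_nth (forest_fps g c) n \<ge> 0"
  unfolding forest_fps_nth[OF order_refl]
  using assms tree_fps_power_nonneg by (intro sum_nonneg mult_nonneg_nonneg) auto

lemma forest_fps_add: "forest_fps g (c + d) = forest_fps g c * forest_fps g d"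
  unfolding forest_fps_def fps_exp_add_mult by (rule fps_compose_mult_distrib) simp

text \<open>Split the set of components into two classes: a weight \<open>c + d\<close> per component amounts
  to a choice between weights \<open>c\<close> and \<open>d\<close>. Only one term of the resulting
  convolution is kept. This is the source of superadditivity.\<close>

lemma forest_fps_supermult:
  assumes "\<And>k. g k \<ge> 0" "c \<ge> 0" "d \<ge> 0"
  shows "fps_nth (forest_fps g c) n * fps_nth (forest_fps g d) m \<le> fps_nth (forest_fps g (c + d)) (n + m)"
proof -
  have "(\<Sum>i\<in>{n}. fps_nth (forest_fps g c) i * fps_nth (forest_fps g d) (n + m - i))
    \<le> (\<Sum>i=0..n+m. fps_nth (forest_fps g c) i * fps_nth (forest_fps g d) (n + m - i))"
    by (rule sum_mono2) (use assms forest_fps_nonneg in auto)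
  then show ?thesis by (simp add: forest_fps_add fps_mult_nth)
qed

text \<open>Mark a vertex: its component becomes a rooted tree, and the rest remains a forest.\<close>

lemma forest_fps_deriv:
  "fps_X * fps_deriv (forest_fps (\<lambda>_. 1) c) = fps_const c * rooted_fps * forest_fps (\<lambda>_. 1) c"
proof -
  have "fps_deriv (forest_fps (\<lambda>_. 1) c) = ((fps_const c * fps_exp c) oo unrooted_fps) * fps_deriv unrooted_fps"
    unfolding forest_fps_def by (subst fps_compose_deriv) simp_all
  also have "(fps_const c * fps_exp c) oo unrooted_fps = fps_const c * forest_fps (\<lambda>_. 1) c"
    by (simp add: forest_fps_def fps_const_mult_apply_left)
  finally show ?thesis by (simp add: rooted_eq_deriv mult_ac)
qed

text \<open>The weights of \<open>m\<close> trees with \<open>n\<close> vertices in total, tilted by the radius of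
  convergence. For fixed \<open>m\<close> they have total mass \<open>(1 / 2) ^ m\<close>; the mean of
  \<open>n\<close> under them is finite, as the rooted series converges at the same point.\<close>

definition "tilted_power m n = fps_nth (unrooted_fps ^ m) n * exp (- 1) ^ n"

lemma tilted_power_nonneg: "tilted_power m n \<ge> 0"
  using tree_fps_power_nonneg by (simp add: tilted_power_def)

lemma fps_mult_sums:
  fixes a b :: "real fps"
  assumes "(\<lambda>n. fps_nth a n * w ^ n) sums x" "(\<lambda>n. fps_nth b n * w ^ n) sums y"
    "\<And>n. fps_nth a n \<ge> 0" "\<And>n. fps_nth b n \<ge> 0" "w \<ge> 0"
  shows "(\<lambda>n. fps_nth (a * b) n * w ^ n) sums (x * y)"
proof -
  have "(\<lambda>k. \<Sum>i\<le>k. (fps_nth a i * w ^ i) * (fps_nth b (k - i) * w ^ (k - i)))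
      sums ((\<Sum>n. fps_nth a n * w ^ n) * (\<Sum>n. fps_nth b n * w ^ n))"
    by (rule Cauchy_product_sums) (use assms in \<open>auto simp: abs_mult sums_iff\<close>)
  then show ?thesis unfolding fps_nth_mult_self_power using assms(1,2) by (simp add: sums_iff)
qed

lemma unrooted_sums: "(\<lambda>n. fps_nth unrooted_fps n * exp (- 1) ^ n) sums (1 / 2)"
  using tree_coeff_sums by (simp add: tree_coeff_def)

lemma rooted_sums: "(\<lambda>n. fps_nth rooted_fps n * exp (- 1) ^ n) sums 1"
  using rooted_coeff_sums by (simp add: rooted_coeff_def)

lemma tilted_power_sums: "tilted_power m sums ((1 / 2) ^ m)"
proof (induction m)
  case 0
  have "(\<lambda>n. if n = 0 then 1 else 0 :: real) sums 1" using sums_single[of 0 "\<lambda>_. 1 :: real"] by simp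
  moreover have "tilted_power 0 = (\<lambda>n. if n = 0 then 1 else 0)" by (auto simp: tilted_power_def)
  ultimately show ?case by simp
next
  case (Suc m)
  have "(\<lambda>n. fps_nth (unrooted_fps * unrooted_fps ^ m) n * exp (- 1) ^ n) sums (1 / 2 * (1 / 2) ^ m)"
    by (rule fps_mult_sums[OF unrooted_sums])
       (use Suc in \<open>auto simp: tilted_power_def[abs_def] tree_fps_nth intro: tree_fps_power_nonneg\<close>)
  then show ?case by (simp add: tilted_power_def[abs_def])
qed

lemma tilted_power_mean_sums: "(\<lambda>n. real n * tilted_power m n) sums (real m * (1 / 2) ^ (m - 1))"
proof (cases m)
  case 0
  have "(\<lambda>n. real n * tilted_power m n) = (\<lambda>_. 0)" by (auto simp: tilted_power_def 0)
  then show ?thesis using 0 by simp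
next
  case (Suc k)
  have D: "fps_X * fps_deriv (unrooted_fps ^ m) = fps_const (real m) * (rooted_fps * unrooted_fps ^ k)"
    unfolding fps_deriv_power rooted_eq_deriv by (simp add: Suc mult_ac)
  have "real n * fps_nth (unrooted_fps ^ m) n = fps_nth (fps_X * fps_deriv (unrooted_fps ^ m)) n" for n
    by (cases n) simp_all
  then have "real n * fps_nth (unrooted_fps ^ m) n = real m * fps_nth (rooted_fps * unrooted_fps ^ k) n" for n
    unfolding D fps_mult_left_const_nth .
  then have e: "real n * tilted_power m n = real m * (fps_nth (rooted_fps * unrooted_fps ^ k) n * exp (- 1) ^ n)" for n
    unfolding tilted_power_def by (metis mult.assoc)
  have "(\<lambda>n. fps_nth (rooted_fps * unrooted_fps ^ k) n * exp (- 1) ^ n) sums (1 * (1 / 2) ^ k)"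
    by (rule fps_mult_sums[OF rooted_sums])
       (use tilted_power_sums[of k] in \<open>auto simp: tilted_power_def[abs_def] tree_fps_nth intro: tree_fps_power_nonneg\<close>)
  then show ?thesis unfolding e using Suc by (auto dest: sums_mult[of _ _ "real m"])
qed

lemma forest_fps_upper:
  assumes "c \<ge> 0"
  shows "fps_nth (forest_fps (\<lambda>_. 1) c) n \<le> exp (real n) * exp (c / 2)"
proof -
  have "tilted_power m n \<le> (1 / 2) ^ m" for m
  proof -
    have "(\<Sum>i\<in>{n}. tilted_power m i) \<le> suminf (tilted_power m)"
      by (rule sum_le_suminf) (use tilted_power_sums[of m] tilted_power_nonneg in \<open>auto simp: sums_iff\<close>)
    then show ?thesis using tilted_power_sums[of m] by (simp add: sums_iff)
  qed
  then have "(\<Sum>m\<le>n. c ^ m / fact m * tilted_power m n) \<le> (\<Sum>m\<le>n. c ^ m / fact m * (1 / 2) ^ m)"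
    using assms by (intro sum_mono mult_left_mono) auto
  also have "\<dots> = (\<Sum>m\<in>{..n}. (c / 2) ^ m /\<^sub>R fact m)"
    by (intro sum.cong) (auto simp: power_divide field_simps)
  also have "\<dots> \<le> (\<Sum>m. (c / 2) ^ m /\<^sub>R fact m)"
    by (rule sum_le_suminf) (use exp_converges[of "c / 2"] assms in \<open>auto simp: sums_iff\<close>)
  also have "\<dots> = exp (c / 2)" using exp_converges[of "c / 2"] by (simp add: sums_iff)
  finally have "fps_nth (forest_fps (\<lambda>_. 1) c) n * exp (- 1) ^ n \<le> exp (c / 2)"
    unfolding forest_fps_nth[OF order_refl] sum_distrib_right tilted_power_def by (simp add: mult_ac)
  moreover have "exp (- 1 :: real) ^ n = inverse (exp (real n))"
    by (simp flip: exp_of_nat_mult exp_minus)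
  ultimately show ?thesis by (simp add: field_simps)
qed

text \<open>Markov's inequality for the event that the total size is at least \<open>n\<close>.\<close>

lemma tilted_power_markov:
  assumes "n \<ge> 1"
  shows "(1 / 2) ^ m - real m * (1 / 2) ^ (m - 1) / real n \<le> (\<Sum>M<n. tilted_power m M)"
proof -
  have 1: "(\<lambda>M. tilted_power m M - real M * tilted_power m M / real n) sums ((1 / 2) ^ m - real m * (1 / 2) ^ (m - 1) / real n)"
    by (intro sums_diff tilted_power_sums sums_divide tilted_power_mean_sums)
  have 2: "(\<lambda>M. if M \<in> {..<n} then tilted_power m M else 0) sums (\<Sum>M<n. tilted_power m M)"
    by (rule sums_If_finite_set) simp
  have 3: "tilted_power m M - real M * tilted_power m M / real n \<le> (if M \<in> {..<n} then tilted_power m M else 0)" for M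
  proof (cases "M < n")
    case False
    then have "1 \<le> real M / real n" using assms by (simp add: field_simps)
    then have "1 * tilted_power m M \<le> real M / real n * tilted_power m M" by (intro mult_right_mono tilted_power_nonneg)
    then show ?thesis using False by simp
  qed (use tilted_power_nonneg in auto)
  show ?thesis by (rule sums_le[OF 3 1 2])
qed

text \<open>Summing \<open>tilted_power_markov\<close> over the number of trees with Poisson weights: the total size has
  mean \<open>c\<close>, so that a fraction \<open>1 - c / n\<close> of the mass sits below \<open>n\<close>.\<close>

lemma forest_fps_partial_sum_lower:
  assumes "c \<ge> 0" "n \<ge> 1"
  shows "(1 - c / real n) * exp (c / 2) \<le> (\<Sum>M<n. fps_nth (forest_fps (\<lambda>_. 1) c) M * exp (- 1) ^ M)"
proof -
  have e: "(\<lambda>m. (c / 2) ^ m / fact m) sums exp (c / 2)"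
  proof -
    have "x ^ m /\<^sub>R fact m = x ^ m / fact m" for x :: real and m
      by (simp only: real_scaleR_def divide_inverse mult.commute)
    then show ?thesis using exp_converges[of "c / 2"] by presburger
  qed
  have "(\<lambda>m. c / real n * ((c / 2) ^ m / fact m)) sums (c / real n * exp (c / 2))"
    by (rule sums_mult[OF e])
  moreover have "c / real n * ((c / 2) ^ m / fact m) = c ^ Suc m / fact (Suc m) * (real (Suc m) * (1 / 2) ^ m / real n)" for m
  proof -
    have "fact (Suc m) = real (Suc m) * fact m" by (rule fact_Suc)
    moreover have "real (Suc m) \<noteq> 0" by simp
    ultimately show ?thesis
      by (simp add: power_divide del: of_nat_Suc fact_Suc)
  qed
  ultimately have "(\<lambda>m. c ^ Suc m / fact (Suc m) * (real (Suc m) * (1 / 2) ^ (Suc m - 1) / real n)) sums (c / real n * exp (c / 2))"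
    by simp
  then have "(\<lambda>m. c ^ m / fact m * (real m * (1 / 2) ^ (m - 1) / real n)) sums (c / real n * exp (c / 2))"
    by (subst (asm) sums_Suc_iff) simp
  note d = sums_diff[OF e this]
  have "(c / 2) ^ m / fact m - c ^ m / fact m * (real m * (1 / 2) ^ (m - 1) / real n)
      = c ^ m / fact m * ((1 / 2) ^ m - real m * (1 / 2) ^ (m - 1) / real n)" for m
    by (simp add: right_diff_distrib power_divide)
  moreover have "exp (c / 2) - c / real n * exp (c / 2) = (1 - c / real n) * exp (c / 2)"
    by (simp add: left_diff_distrib)
  ultimately have 1: "(\<lambda>m. c ^ m / fact m * ((1 / 2) ^ m - real m * (1 / 2) ^ (m - 1) / real n)) sums ((1 - c / real n) * exp (c / 2))"
    using d by presburger
  let ?f = "\<lambda>m. c ^ m / fact m * (\<Sum>M<n. tilted_power m M)"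
  have z: "?f m = 0" if "m \<notin> {..n}" for m
    using that by (auto simp: tilted_power_def tree_fps_power_low)
  have 2: "?f sums (\<Sum>m\<le>n. ?f m)"
    by (rule sums_finite) (use z in auto)
  have "(1 - c / real n) * exp (c / 2) \<le> (\<Sum>m\<le>n. ?f m)"
    by (rule sums_le[OF _ 1 2]) (intro mult_left_mono tilted_power_markov, use assms in auto)
  also have "\<dots> = (\<Sum>M<n. \<Sum>m\<le>n. c ^ m / fact m * tilted_power m M)"
    unfolding sum_distrib_left by (rule sum.swap)
  also have "\<dots> = (\<Sum>M<n. fps_nth (forest_fps (\<lambda>_. 1) c) M * exp (- 1) ^ M)"
    by (intro sum.cong refl) (simp add: forest_fps_nth[of _ n] sum_distrib_left tilted_power_def mult_ac)
  finally show ?thesis .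
qed

lemma rooted_coeff_lower: "j \<ge> 1 \<Longrightarrow> rooted_coeff j * exp (- 1) ^ j \<ge> 1 / (exp 1 * real j ^ 2)"
proof -
  assume j: "j \<ge> 1"
  have "fact j \<le> exp 1 * real j ^ Suc j * exp (- real j)" by (rule fact_le_exp_power[OF j])
  also have "exp (- real j) = exp (- 1) ^ j" by (simp flip: exp_of_nat_mult)
  finally have "1 \<le> exp 1 * real j * (real j ^ j / fact j * exp (- 1) ^ j)"
    by (simp add: field_simps)
  also have "real j ^ j / fact j = real j * rooted_coeff j" using birooted_coeff_nth[OF j] by (simp add: birooted_coeff_def rooted_coeff_def)
  finally show ?thesis using j by (simp add: field_simps power2_eq_square)
qed

text \<open>The idea behind the supercritical regime: below \<open>n\<close> the tilted weights carry a positive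
  fraction of their mass \<open>exp (c / 2)\<close> whenever \<open>c < n\<close>, and the missing vertices are
  supplied by one giant tree. By \<open>rooted_coeff_lower\<close> a giant tree costs only a polynomial factor.\<close>

lemma forest_fps_lower:
  assumes "c \<ge> 0" "n \<ge> 1"
  shows "exp (real n) * (c / (exp 1 * real n ^ 3) * ((1 - c / real n) * exp (c / 2)))
    \<le> fps_nth (forest_fps (\<lambda>_. 1) c) n"
proof -
  let ?E = "\<lambda>k. fps_nth (forest_fps (\<lambda>_. 1) c) k * exp (- 1) ^ k"
  have E0: "?E k \<ge> 0" for k using forest_fps_nonneg[of "\<lambda>_. 1" c k] assms by simp
  have X: "fps_nth (fps_X * fps_deriv f) n = real n * fps_nth f n" for f :: "real fps"
    using assms by (cases n) simp_all
  have "real n * ?E n = fps_nth (fps_const c * (rooted_fps * forest_fps (\<lambda>_. 1) c)) n * exp (- 1) ^ n"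
    using X[of "forest_fps (\<lambda>_. 1) c"] unfolding forest_fps_deriv by (simp add: mult_ac)
  also have "\<dots> = c * (\<Sum>i\<le>n. (rooted_coeff i * exp (- 1) ^ i) * ?E (n - i))"
    unfolding fps_mult_left_const_nth mult.assoc[of c] fps_nth_mult_self_power by (simp add: rooted_coeff_def)
  also have "\<dots> \<ge> c * (\<Sum>i=1..n. (1 / (exp 1 * real n ^ 2)) * ?E (n - i))"
  proof (intro mult_left_mono)
    have "(\<Sum>i=1..n. (1 / (exp 1 * real n ^ 2)) * ?E (n - i)) \<le> (\<Sum>i=1..n. (rooted_coeff i * exp (- 1) ^ i) * ?E (n - i))"
    proof (intro sum_mono mult_right_mono E0)
      fix i assume i: "i \<in> {1..n}"
      then have "1 / (exp 1 * real n ^ 2) \<le> 1 / (exp 1 * real i ^ 2)"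
        by (intro divide_left_mono mult_left_mono power_mono mult_pos_pos) auto
      also have "\<dots> \<le> rooted_coeff i * exp (- 1) ^ i" using rooted_coeff_lower i by simp
      finally show "1 / (exp 1 * real n ^ 2) \<le> rooted_coeff i * exp (- 1) ^ i" .
    qed
    also have "\<dots> \<le> (\<Sum>i\<le>n. (rooted_coeff i * exp (- 1) ^ i) * ?E (n - i))"
      by (rule sum_mono2) (use E0 tree_coeffs_nonneg in auto)
    finally show "(\<Sum>i=1..n. (1 / (exp 1 * real n ^ 2)) * ?E (n - i)) \<le> (\<Sum>i\<le>n. (rooted_coeff i * exp (- 1) ^ i) * ?E (n - i))" .
  qed (use assms in auto)
  also have "(\<Sum>i=1..n. (1 / (exp 1 * real n ^ 2)) * ?E (n - i)) = 1 / (exp 1 * real n ^ 2) * (\<Sum>M<n. ?E M)"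
    unfolding sum_distrib_left
    by (rule sum.reindex_bij_witness[of _ "\<lambda>M. n - M" "\<lambda>i. n - i"]) auto
  finally have 1: "c * (1 / (exp 1 * real n ^ 2) * (\<Sum>M<n. ?E M)) \<le> real n * ?E n" .
  have "c * (1 / (exp 1 * real n ^ 2) * ((1 - c / real n) * exp (c / 2))) \<le> c * (1 / (exp 1 * real n ^ 2) * (\<Sum>M<n. ?E M))"
    using forest_fps_partial_sum_lower[OF assms] assms by (intro mult_left_mono) auto
  with 1 have 2: "c * (1 / (exp 1 * real n ^ 2) * ((1 - c / real n) * exp (c / 2))) \<le> real n * ?E n" by linarith
  have "exp (real n) * (c / (exp 1 * real n ^ 3) * ((1 - c / real n) * exp (c / 2)))
     = exp (real n) / real n * (c * (1 / (exp 1 * real n ^ 2) * ((1 - c / real n) * exp (c / 2))))"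
    by (simp add: power2_eq_square power3_eq_cube)
  also have "\<dots> \<le> exp (real n) / real n * (real n * ?E n)"
    by (rule mult_left_mono[OF 2]) simp
  also have "\<dots> = fps_nth (forest_fps (\<lambda>_. 1) c) n"
  proof -
    have "exp (- 1 :: real) ^ n = inverse (exp (real n))"
      by (simp flip: exp_of_nat_mult exp_minus)
    then show ?thesis using assms by simp
  qed
  finally show ?thesis .
qed

section \<open>The forest polynomial and its growth rate\<close>

definition sized_forests :: "nat set \<Rightarrow> nat \<Rightarrow> nat set set set" where
  "sized_forests R n = {F \<in> forests {..<n}. \<forall>C\<in>comps {..<n} F. card C \<in> R}"

definition forest_poly :: "nat set \<Rightarrow> nat \<Rightarrow> real \<Rightarrow> real" where
  "forest_poly R n t = (\<Sum>F\<in>sized_forests R n. t ^ card F)"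

definition size_indicator :: "nat set \<Rightarrow> nat \<Rightarrow> real" where
  "size_indicator R k = (if k \<in> R then 1 else 0)"

lemma size_indicator_nonneg [simp]: "size_indicator R k \<ge> 0" and size_indicator_UNIV: "size_indicator UNIV = (\<lambda>_. 1)"
  by (auto simp: size_indicator_def)

lemma finite_sized_forests [simp]: "finite (sized_forests R n)"
  by (simp add: sized_forests_def)

lemma sized_forestsD: "F \<in> sized_forests R n \<Longrightarrow> F \<in> forests {..<n}"
  by (simp add: sized_forests_def)

lemma empty_in_sized_forests: "1 \<in> R \<Longrightarrow> {} \<in> sized_forests R n"
  by (auto simp: sized_forests_def forests_def acyc_def comps_empty)

lemma sized_forests_mono: "R \<subseteq> R' \<Longrightarrow> sized_forests R n \<subseteq> sized_forests R' n"
  by (auto simp: sized_forests_def)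

lemma sized_forests_atMost: "n \<le> r \<Longrightarrow> sized_forests {..r} n = sized_forests UNIV n"
proof -
  assume r: "n \<le> r"
  have "card C \<le> n" if "F \<in> forests {..<n}" "C \<in> comps {..<n} F" for F C
    using card_mono[OF _ comps_subset[OF _ that(2)]] that(1) by (simp add: forests_def)
  then show ?thesis using r unfolding sized_forests_def by fastforce
qed

text \<open>A forest with \<open>m\<close> components has \<open>n - m\<close> edges, so edge weight \<open>t\<close>
  amounts to a global factor \<open>t ^ n\<close> and component weight \<open>1 / t\<close>.\<close>

lemma forest_poly_eq_fps:
  assumes "t > 0"
  shows "forest_poly R n t = t ^ n * fact n * fps_nth (forest_fps (size_indicator R) (1 / t)) n"
proof -
  let ?V = "{..<n}"
  have cw: "comp_weight (size_indicator R) ?V F = (if \<forall>C\<in>comps ?V F. card C \<in> R then 1 else 0)" for F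
    by (auto simp: comp_weight_def size_indicator_def intro!: prod.neutral)
  have "forest_poly R n t = (\<Sum>F\<in>forests ?V. comp_weight (size_indicator R) ?V F * t ^ card F)"
    unfolding forest_poly_def sized_forests_def by (intro sum.mono_neutral_cong_left) (auto simp: cw)
  also have "\<dots> = (\<Sum>m\<le>n. \<Sum>F\<in>{F \<in> forests ?V. card (comps ?V F) = m}. comp_weight (size_indicator R) ?V F * t ^ card F)"
  proof (rule sum.group[symmetric])
    show "(\<lambda>F. card (comps ?V F)) ` forests ?V \<subseteq> {..n}"
      using forest_card[of ?V] by fastforce
  qed auto
  also have "\<dots> = (\<Sum>m\<le>n. t ^ n * (1 / t) ^ m * forest_sum (size_indicator R) ?V m)"
    unfolding forest_sum_def forests_with_def sum_distrib_left
  proof (intro sum.cong refl)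
    fix m F assume "F \<in> {F \<in> forests ?V. card (comps ?V F) = m}"
    then have "n = card F + m" using forest_card[of ?V F] by simp
    then show "comp_weight (size_indicator R) ?V F * t ^ card F = t ^ n * (1 / t) ^ m * comp_weight (size_indicator R) ?V F"
      using assms by (simp add: power_add power_divide)
  qed
  also have "\<dots> = t ^ n * fact n * fps_nth (forest_fps (size_indicator R) (1 / t)) n"
    unfolding forest_fps_nth[OF order_refl] sum_distrib_left
    by (intro sum.cong refl) (simp add: forest_sum_eq_fps)
  finally show ?thesis .
qed

lemma forest_poly_ge_1: "1 \<in> R \<Longrightarrow> t \<ge> 0 \<Longrightarrow> forest_poly R n t \<ge> 1"
  using sum_mono2[of "sized_forests R n" "{{}}" "\<lambda>F. t ^ card F"] empty_in_sized_forests[of R n] by (auto simp: forest_poly_def)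

lemma forest_poly_mono: "0 \<le> t \<Longrightarrow> t \<le> s \<Longrightarrow> forest_poly R n t \<le> forest_poly R n s"
  unfolding forest_poly_def by (intro sum_mono power_mono)

lemma forest_poly_subset: "R \<subseteq> R' \<Longrightarrow> 0 \<le> t \<Longrightarrow> forest_poly R n t \<le> forest_poly R' n t"
  unfolding forest_poly_def by (intro sum_mono2 sized_forests_mono) auto

lemma forest_poly_scale:
  assumes "a \<ge> 1" "t \<ge> 0"
  shows "forest_poly R n (a * t) \<le> a ^ n * forest_poly R n t"
  unfolding forest_poly_def sum_distrib_left
proof (rule sum_mono)
  fix F assume "F \<in> sized_forests R n"
  then have "card F \<le> n" using forest_card[of "{..<n}" F] sized_forestsD by fastforce
  then have "a ^ card F \<le> a ^ n" using assms by (intro power_increasing) auto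
  then show "(a * t) ^ card F \<le> a ^ n * t ^ card F"
    using assms by (simp add: power_mult_distrib mult_right_mono)
qed

lemma card_pairs: "real (card (pairs {..<n})) = real n * (real n - 1) / 2"
proof -
  have "card (pairs {..<n}) = n choose 2" using n_subsets[of "{..<n}" 2] by (simp add: pairs_def)
  then have "2 * card (pairs {..<n}) = n * (n - 1)"
    by (cases n) (simp_all add: choose_two)
  then have "2 * real (card (pairs {..<n})) = real n * real (n - 1)"
    by (metis of_nat_mult of_nat_numeral)
  then show ?thesis by (cases n) (simp_all add: algebra_simps)
qed

text \<open>Expanding \<open>(t + d) ^ card F\<close> colours the edges of \<open>F\<close> with two colours. The edges
  of the first colour form a forest again, and those of the second one form an arbitrary set of
  edges.\<close>

lemma forest_poly_add:
  assumes "t \<ge> 0" "d \<ge> 0"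
  shows "forest_poly UNIV n (t + d) \<le> forest_poly UNIV n t * (1 + d) ^ card (pairs {..<n})"
proof -
  let ?P = "pairs {..<n}" and ?S = "sized_forests UNIV n"
  have f: "finite F" if "F \<in> ?S" for F
    using finite_forest[of "{..<n}"] that sized_forestsD by blast
  have "forest_poly UNIV n (t + d) = (\<Sum>F\<in>?S. \<Sum>A\<in>Pow F. t ^ card A * d ^ card (F - A))"
    unfolding forest_poly_def
  proof (rule sum.cong[OF refl])
    fix F assume "F \<in> ?S"
    then show "(t + d) ^ card F = (\<Sum>A\<in>Pow F. t ^ card A * d ^ card (F - A))"
      using prod_add[OF f, of F "\<lambda>_. t" "\<lambda>_. d"] by simp
  qed
  also have "\<dots> = (\<Sum>(F, A)\<in>Sigma ?S Pow. t ^ card A * d ^ card (F - A))"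
    using f by (subst sum.Sigma) auto
  also have "\<dots> = (\<Sum>(A, B)\<in>(\<lambda>(F, A). (A, F - A)) ` Sigma ?S Pow. t ^ card A * d ^ card B)"
    by (subst sum.reindex) (auto simp: inj_on_def case_prod_unfold)
  also have "\<dots> \<le> (\<Sum>(A, B)\<in>?S \<times> Pow ?P. t ^ card A * d ^ card B)"
  proof (rule sum_mono2)
    show "(\<lambda>(F, A). (A, F - A)) ` Sigma ?S Pow \<subseteq> ?S \<times> Pow ?P"
      by (auto simp: sized_forests_def forests_def intro: acyc_mono)
  qed (use assms in auto)
  also have "\<dots> = forest_poly UNIV n t * (\<Sum>B\<in>Pow ?P. d ^ card B)"
    by (simp add: forest_poly_def sum_product sum.cartesian_product)
  also have "(\<Sum>B\<in>Pow ?P. d ^ card B) = (1 + d) ^ card ?P"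
    using prod_add[of ?P "\<lambda>_. d" "\<lambda>_. 1"] by (simp add: add.commute)
  finally show ?thesis .
qed

text \<open>The edge weight is scaled as \<open>x / n\<close>, for which the growth is exponential in \<open>n\<close>.\<close>

definition growth_rate :: "nat set \<Rightarrow> nat \<Rightarrow> real \<Rightarrow> real" where
  "growth_rate R n x = ln (forest_poly R n (x / real n)) / real n"

text \<open>A forest has at most \<open>n\<close> edges, so scaling the edge weight by a factor \<open>a \<ge> 1\<close>
  raises the polynomial by at most \<open>a ^ n\<close>. The resulting Lipschitz bound does not depend on
  \<open>n\<close> or on the admitted sizes, and it is what makes all limits locally uniform.\<close>

lemma growth_rate_lipschitz_aux:
  assumes "1 \<in> R" "n \<ge> 1" "0 < x" "x \<le> y"
  shows "growth_rate R n x \<le> growth_rate R n y" "growth_rate R n y \<le> growth_rate R n x + (ln y - ln x)"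
proof -
  have p: "forest_poly R n (x / real n) \<ge> 1" "forest_poly R n (y / real n) \<ge> 1" using assms by (auto intro!: forest_poly_ge_1)
  have "forest_poly R n (x / real n) \<le> forest_poly R n (y / real n)"
    using assms by (intro forest_poly_mono) (auto simp: divide_right_mono)
  then show "growth_rate R n x \<le> growth_rate R n y" unfolding growth_rate_def using p assms by (intro divide_right_mono) auto
  have "forest_poly R n (y / real n) \<le> (y / x) ^ n * forest_poly R n (x / real n)"
    using forest_poly_scale[of "y / x" "x / real n" R n] assms by simp
  then have "ln (forest_poly R n (y / real n)) \<le> ln ((y / x) ^ n * forest_poly R n (x / real n))"
    using p assms by (intro ln_mono) auto
  also have "\<dots> = real n * (ln y - ln x) + ln (forest_poly R n (x / real n))"
    using p assms by (simp add: ln_mult ln_realpow ln_div)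
  finally show "growth_rate R n y \<le> growth_rate R n x + (ln y - ln x)"
    unfolding growth_rate_def using assms by (simp add: field_simps)
qed

lemma growth_rate_lipschitz:
  assumes "1 \<in> R" "n \<ge> 1" "0 < x" "0 < y"
  shows "\<bar>growth_rate R n x - growth_rate R n y\<bar> \<le> \<bar>ln x - ln y\<bar>"
proof (cases "x \<le> y")
  case True
  then show ?thesis using growth_rate_lipschitz_aux[OF assms(1-3) True] by linarith
next
  case False
  then show ?thesis using growth_rate_lipschitz_aux[OF assms(1,2,4), of x] by linarith
qed

text \<open>For the complete graph the edge set counted in \<open>forest_poly_add\<close> contributes at most
  \<open>exp (n * (y - x) / 2)\<close>. With \<open>x = 0\<close> this is the sharp upper bound in the subcritical
  regime; read backwards, it transports lower bounds from larger to smaller arguments.\<close>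

lemma growth_rate_add:
  assumes "n \<ge> 1" "0 \<le> x" "x \<le> y"
  shows "growth_rate UNIV n y \<le> growth_rate UNIV n x + (y - x) / 2"
proof -
  let ?N = "card (pairs {..<n})" and ?d = "(y - x) / real n"
  have p: "forest_poly UNIV n (x / real n) \<ge> 1" "forest_poly UNIV n (y / real n) \<ge> 1" using assms by (auto intro!: forest_poly_ge_1)
  have "?d \<ge> 0" "x / real n + ?d = y / real n" using assms by (simp, simp add: diff_divide_distrib)
  then have "forest_poly UNIV n (y / real n) \<le> forest_poly UNIV n (x / real n) * (1 + ?d) ^ ?N"
    using forest_poly_add[of "x / real n" ?d n] assms by simp
  also have "\<dots> \<le> forest_poly UNIV n (x / real n) * exp ?d ^ ?N"
    using p assms by (intro mult_left_mono power_mono exp_ge_add_one_self) auto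
  finally have "ln (forest_poly UNIV n (y / real n)) \<le> ln (forest_poly UNIV n (x / real n) * exp ?d ^ ?N)"
    using p by (intro ln_mono) auto
  also have "\<dots> = ln (forest_poly UNIV n (x / real n)) + real ?N * ?d"
    using p by (simp add: ln_mult ln_realpow)
  also have "real ?N * ?d \<le> real n * ((y - x) / 2)"
  proof -
    have "real ?N * ?d = (real n - 1) * ((y - x) / 2)" using assms by (simp add: card_pairs)
    also have "\<dots> \<le> real n * ((y - x) / 2)" using assms by (intro mult_right_mono) auto
    finally show ?thesis .
  qed
  finally show ?thesis unfolding growth_rate_def using assms by (simp add: field_simps)
qed

lemma growth_rate_0: "growth_rate UNIV n 0 = 0"
proof -
  have "forest_poly UNIV n 0 = (\<Sum>F\<in>sized_forests UNIV n. if F = {} then 1 else 0)" unfolding forest_poly_def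
  proof (rule sum.cong[OF refl])
    fix F assume "F \<in> sized_forests UNIV n"
    then have "finite F" using finite_forest[of "{..<n}"] sized_forestsD by blast
    then show "(0::real) ^ card F = (if F = {} then 1 else 0)" by (auto simp: card_gt_0_iff)
  qed
  also have "\<dots> = 1" using empty_in_sized_forests[of UNIV n] by simp
  finally show ?thesis by (simp add: growth_rate_def)
qed

text \<open>The part of \<open>n * growth_rate R n x\<close> left after removal of explicit factors; it is superadditive
  in \<open>n\<close>.\<close>

definition log_coeff :: "nat set \<Rightarrow> real \<Rightarrow> nat \<Rightarrow> real" where
  "log_coeff R x n = ln (fps_nth (forest_fps (size_indicator R) (real n / x)) n)"

lemma forest_fps_nth_pos:
  assumes "1 \<in> R" "x > 0"
  shows "fps_nth (forest_fps (size_indicator R) (real n / x)) n > 0"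
proof (cases "n = 0")
  case False
  then have t: "x / real n > 0" using assms by simp
  have "0 < forest_poly R n (x / real n)" using forest_poly_ge_1[OF assms(1), of "x / real n" n] t by linarith
  then show ?thesis unfolding forest_poly_eq_fps[OF t] divide_divide_eq_right mult_1 by (rule zero_less_mult_pos) (use t in simp)
qed (simp add: forest_fps_def)

lemma growth_rate_eq_log_coeff:
  assumes "1 \<in> R" "n \<ge> 1" "x > 0"
  shows "growth_rate R n x = ln x + (ln (fact n) / real n - ln (real n)) + log_coeff R x n / real n"
proof -
  have t: "x / real n > 0" using assms by simp
  have "ln (forest_poly R n (x / real n)) = real n * (ln x - ln (real n)) + ln (fact n) + log_coeff R x n"
    unfolding forest_poly_eq_fps[OF t] log_coeff_def using forest_fps_nth_pos[OF assms(1,3), of n] assms t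
    by (simp add: ln_mult ln_realpow ln_div)
  then show ?thesis unfolding growth_rate_def using assms by (simp add: field_simps)
qed

lemma ln_fact_lim: "(\<lambda>n. ln (fact n) / real n - ln (real n)) \<longlonglongrightarrow> -1"
proof (rule tendsto_sandwich)
  show "\<forall>\<^sub>F n in sequentially. - 1 \<le> ln (fact n) / real n - ln (real n)"
    using eventually_ge_at_top[of 1]
  proof eventually_elim
    case (elim n)
    have "ln (real n ^ n) \<le> ln (exp (real n) * fact n)"
      using power_self_le_exp_fact[of n] elim by (intro ln_mono) auto
    then show ?case using elim by (simp add: ln_mult ln_realpow field_simps)
  qed
  show "\<forall>\<^sub>F n in sequentially. ln (fact n) / real n - ln (real n) \<le> 1 / real n + ln (real n) / real n - 1"
    using eventually_ge_at_top[of 1]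
  proof eventually_elim
    case (elim n)
    have "ln (fact n) \<le> ln (exp 1 * real n ^ Suc n * exp (- real n))"
      using fact_le_exp_power[OF elim] elim by (intro ln_mono) auto
    also have "\<dots> = 1 + (real n + 1) * ln (real n) - real n"
      using elim by (simp add: ln_mult ln_realpow algebra_simps del: power_Suc)
    finally have "ln (fact n) / real n \<le> (1 + (real n + 1) * ln (real n) - real n) / real n"
      by (rule divide_right_mono) simp
    moreover have "(1 + (real n + 1) * l - real n) / real n = 1 / real n + l / real n - 1 + l" for l
      using elim by (simp add: field_simps)
    ultimately show ?case by simp
  qed
  have "(\<lambda>n. 1 / real n + ln (real n) / real n - 1) \<longlonglongrightarrow> 0 + 0 - 1"
    by (intro tendsto_intros lim_1_over_n)
  then show "(\<lambda>n. 1 / real n + ln (real n) / real n - 1) \<longlonglongrightarrow> - 1" by simp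
qed simp

text \<open>The growth rate of the forest polynomial; the two formulas agree at \<open>x = 1\<close>, where the
  giant tree appears.\<close>

definition forest_rate :: "real \<Rightarrow> real" where
  "forest_rate x = (if x \<le> 1 then x / 2 else ln x + 1 / (2 * x))"

text \<open>Here \<open>c = n / x < n\<close>, and both bounds on the coefficients of \<open>exp (c * U)\<close>
  are \<open>exp (n + n / (2 * x))\<close> up to polynomial factors. The factor \<open>exp n\<close> cancels
  against Stirling's formula.\<close>

lemma growth_rate_lim_gt1:
  assumes x: "x > 1"
  shows "(\<lambda>n. growth_rate UNIV n x) \<longlonglongrightarrow> ln x + 1 / (2 * x)"
proof -
  have "(\<lambda>n. log_coeff UNIV x n / real n) \<longlonglongrightarrow> 1 + 1 / (2 * x)"
  proof (rule tendsto_sandwich)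
    let ?k = "ln (1 / (exp 1 * x) * (1 - 1 / x))"
    show "\<forall>\<^sub>F n in sequentially. 1 + 1 / (2 * x) + (?k * (1 / real n) - 2 * (ln (real n) / real n)) \<le> log_coeff UNIV x n / real n"
      using eventually_ge_at_top[of 1]
    proof eventually_elim
      case (elim n)
      let ?c = "real n / x"
      have n: "real n > 0" using elim by simp
      have eq: "exp (real n) * (?c / (exp 1 * real n ^ 3) * ((1 - ?c / real n) * exp (?c / 2)))
          = exp (real n + ?c / 2) * (1 / (exp 1 * x) * (1 - 1 / x)) / real n ^ 2"
        using n x by (simp add: exp_add power2_eq_square power3_eq_cube mult_ac)
      have k: "1 / (exp 1 * x) * (1 - 1 / x) > 0" using x by (intro mult_pos_pos) auto
      have "exp (real n + ?c / 2) * (1 / (exp 1 * x) * (1 - 1 / x)) / real n ^ 2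
        \<le> fps_nth (forest_fps (size_indicator UNIV) ?c) n"
        using forest_fps_lower[of ?c n] x elim unfolding eq size_indicator_UNIV by simp
      then have "ln (exp (real n + ?c / 2) * (1 / (exp 1 * x) * (1 - 1 / x)) / real n ^ 2) \<le> log_coeff UNIV x n"
        unfolding log_coeff_def by (rule ln_mono) (intro divide_pos_pos mult_pos_pos k; use n x in simp)+
      also have "ln (exp (real n + ?c / 2) * (1 / (exp 1 * x) * (1 - 1 / x)) / real n ^ 2)
          = real n + ?c / 2 + ?k - 2 * ln (real n)"
      proof -
        have "ln (exp A * K / real n ^ 2) = A + ln K - 2 * ln (real n)" if "K > 0" for A K
          using that n by (simp add: ln_mult ln_div ln_realpow)
        from this[OF k] show ?thesis .
      qed
      finally have "(real n + ?c / 2 + ?k - 2 * ln (real n)) / real n \<le> log_coeff UNIV x n / real n"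
        by (rule divide_right_mono) simp
      moreover have "(real n + ?c / 2 + K - 2 * ln (real n)) / real n
          = 1 + 1 / (2 * x) + (K * (1 / real n) - 2 * (ln (real n) / real n))" for K
        using n x by (simp add: field_simps)
      ultimately show ?case by simp
    qed
    show "\<forall>\<^sub>F n in sequentially. log_coeff UNIV x n / real n \<le> 1 + 1 / (2 * x)"
      using eventually_ge_at_top[of 1]
    proof eventually_elim
      case (elim n)
      have "log_coeff UNIV x n \<le> ln (exp (real n) * exp (real n / x / 2))"
        unfolding log_coeff_def
        by (rule ln_mono[OF _ forest_fps_nth_pos]) (use forest_fps_upper[of "real n / x" n] x in \<open>auto simp: size_indicator_UNIV\<close>)
      also have "\<dots> = real n * (1 + 1 / (2 * x))" by (simp add: field_simps flip: exp_add)
      finally show ?case using elim by (simp add: field_simps)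
    qed
    have "(\<lambda>n. 1 + 1 / (2 * x) + (?k * (1 / real n) - 2 * (ln (real n) / real n))) \<longlonglongrightarrow> 1 + 1 / (2 * x) + (?k * 0 - 2 * 0)"
      by (intro tendsto_intros lim_1_over_n)
    then show "(\<lambda>n. 1 + 1 / (2 * x) + (?k * (1 / real n) - 2 * (ln (real n) / real n))) \<longlonglongrightarrow> 1 + 1 / (2 * x)" by simp
  qed simp
  then have "(\<lambda>n. ln x + (ln (fact n) / real n - ln (real n)) + log_coeff UNIV x n / real n) \<longlonglongrightarrow> ln x + (-1) + (1 + 1 / (2 * x))"
    by (intro tendsto_intros ln_fact_lim)
  moreover have "\<forall>\<^sub>F n in sequentially. ln x + (ln (fact n) / real n - ln (real n)) + log_coeff UNIV x n / real n = growth_rate UNIV n x"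
    using eventually_ge_at_top[of 1] by eventually_elim (use x in \<open>auto simp: growth_rate_eq_log_coeff\<close>)
  ultimately have "(\<lambda>n. growth_rate UNIV n x) \<longlonglongrightarrow> ln x + (-1) + (1 + 1 / (2 * x))"
    by (rule Lim_transform_eventually)
  then show ?thesis by simp
qed

text \<open>For \<open>x \<le> 1\<close> the upper bound is \<open>growth_rate_add\<close> from \<open>0\<close> to \<open>x\<close>. The lower
  bound is \<open>growth_rate_add\<close> from \<open>x\<close> to some \<open>y > 1\<close>, where the limit is known, with
  \<open>y\<close> tending to \<open>1\<close>.\<close>

lemma growth_rate_lim:
  assumes x: "x > 0"
  shows "(\<lambda>n. growth_rate UNIV n x) \<longlonglongrightarrow> forest_rate x"
proof (cases "x \<le> 1")
  case False
  then show ?thesis using growth_rate_lim_gt1[of x] by (simp add: forest_rate_def)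
next
  case True
  have "(\<lambda>n. growth_rate UNIV n x) \<longlonglongrightarrow> x / 2"
  proof (rule order_tendstoI)
    fix a assume a: "x / 2 < a"
    show "\<forall>\<^sub>F n in sequentially. growth_rate UNIV n x < a"
      using eventually_ge_at_top[of 1]
    proof eventually_elim
      case (elim n)
      then show ?case using growth_rate_add[of n 0 x] x growth_rate_0 a by simp
    qed
  next
    fix a assume a: "a < x / 2"
    have "((\<lambda>y. ln y + 1 / (2 * y) - (y - x) / 2) \<longlongrightarrow> ln 1 + 1 / (2 * 1) - (1 - x) / 2) (at_right (1::real))"
      by (intro tendsto_intros) auto
    then have "\<forall>\<^sub>F y in at_right (1::real). a < ln y + 1 / (2 * y) - (y - x) / 2"
      by (rule order_tendstoD(1)) (use a in \<open>simp add: field_simps\<close>)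
    then have "\<forall>\<^sub>F y in at_right (1::real). a < ln y + 1 / (2 * y) - (y - x) / 2 \<and> 1 < y"
      using eventually_at_right_less by (rule eventually_conj)
    then obtain y where y: "a + (y - x) / 2 < ln y + 1 / (2 * y)" "1 < y"
      using eventually_happens'[OF trivial_limit_at_right_real] by (force simp: algebra_simps)
    have "\<forall>\<^sub>F n in sequentially. a + (y - x) / 2 < growth_rate UNIV n y"
      by (rule order_tendstoD(1)[OF growth_rate_lim_gt1[OF y(2)] y(1)])
    then show "\<forall>\<^sub>F n in sequentially. a < growth_rate UNIV n x"
      using eventually_ge_at_top[of 1]
    proof eventually_elim
      case (elim n)
      then show ?case using growth_rate_add[of n x y] x y True by linarith
    qed
  qed
  then show ?thesis using True by (simp add: forest_rate_def)
qed

section \<open>Bounded component sizes\<close>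

text \<open>Fekete's lemma. The limit is the supremum of the quotients, and it is this fact that later
  allows to exchange the limits over the number of vertices and over the component size.\<close>

lemma fekete:
  fixes a :: "nat \<Rightarrow> real"
  assumes super: "\<And>m n. a m + a n \<le> a (m + n)" and zero: "a 0 = 0"
    and bound: "\<And>n. a n \<le> C * real n"
  obtains L where "(\<lambda>n. a n / real n) \<longlonglongrightarrow> L" "\<And>n. n \<ge> 1 \<Longrightarrow> a n / real n \<le> L"
proof -
  define L where "L = (SUP n\<in>{1..}. a n / real n)"
  have bdd: "bdd_above ((\<lambda>n. a n / real n) ` {1..})"
    by (rule bdd_aboveI2[of _ _ C]) (use bound in \<open>auto simp: field_simps\<close>)
  have up: "a n / real n \<le> L" if "n \<ge> 1" for n
    unfolding L_def by (rule cSUP_upper[OF _ bdd]) (use that in auto)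
  have mult: "real q * a m \<le> a (q * m)" for q m
  proof (induction q)
    case (Suc q)
    have "real (Suc q) * a m = a m + real q * a m" by (simp add: algebra_simps)
    also have "\<dots> \<le> a m + a (q * m)" using Suc by simp
    also have "\<dots> \<le> a (Suc q * m)" using super[of m "q * m"] by simp
    finally show ?case .
  qed (simp add: zero)
  have "(\<lambda>n. a n / real n) \<longlonglongrightarrow> L"
  proof (rule order_tendstoI)
    fix b assume "L < b"
    show "\<forall>\<^sub>F n in sequentially. a n / real n < b"
      using eventually_ge_at_top[of 1] by eventually_elim (use up \<open>L < b\<close> in force)
  next
    fix b assume b: "b < L"
    then obtain m where m: "m \<ge> 1" "b < a m / real m"
      unfolding L_def by (subst (asm) less_cSUP_iff[OF _ bdd]) auto
    \<comment> \<open>Bounds the error from replacing \<open>n\<close> by a multiple of \<open>m\<close>.\<close>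
    define D where "D = (\<Sum>i<m. \<bar>a i\<bar>) + \<bar>a m\<bar>"
    have lower: "a m / real m - D * (1 / real n) \<le> a n / real n" if n: "n \<ge> 1" for n
    proof -
      define q where "q = n div m"
      define r where "r = n mod m"
      have nq: "n = q * m + r" "r < m" using m by (auto simp: q_def r_def)
      have "real q * a m + a r \<le> a n" using mult[of q m] super[of "q * m" r] unfolding nq(1)[symmetric] by linarith
      moreover have "\<bar>a r\<bar> \<le> (\<Sum>i<m. \<bar>a i\<bar>)"
        by (rule member_le_sum) (use nq in auto)
      moreover have "real q * a m = a m / real m * real n - a m / real m * real r"
        using m nq by (simp add: field_simps)
      moreover have "a m / real m * real r \<le> \<bar>a m\<bar>"
      proof -
        have "a m / real m * real r \<le> \<bar>a m\<bar> / real m * real m"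
          using nq by (intro mult_mono divide_right_mono) auto
        then show ?thesis using m by simp
      qed
      ultimately have "a m / real m * real n - D \<le> a n" unfolding D_def by linarith
      then have "(a m / real m * real n - D) / real n \<le> a n / real n" by (rule divide_right_mono) simp
      then show ?thesis using n by (simp add: diff_divide_distrib)
    qed
    have "(\<lambda>n. a m / real m - D * (1 / real n)) \<longlonglongrightarrow> a m / real m - D * 0"
      by (intro tendsto_intros lim_1_over_n)
    then have "\<forall>\<^sub>F n in sequentially. b < a m / real m - D * (1 / real n)"
      by (rule order_tendstoD(1)) (use m in simp)
    then show "\<forall>\<^sub>F n in sequentially. b < a n / real n"
      using eventually_ge_at_top[of 1] by eventually_elim (use lower in force)
  qed
  with up that show thesis by blast
qed

lemma log_coeff_limit:
  assumes "1 \<in> R" "x > 0"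
  obtains L where "(\<lambda>n. log_coeff R x n / real n) \<longlonglongrightarrow> L" "\<And>n. n \<ge> 1 \<Longrightarrow> log_coeff R x n / real n \<le> L"
proof (rule fekete[of "log_coeff R x" "1 + 1 / (2 * x)"])
  show "log_coeff R x m + log_coeff R x n \<le> log_coeff R x (m + n)" for m n
  proof -
    have "ln (fps_nth (forest_fps (size_indicator R) (real m / x)) m * fps_nth (forest_fps (size_indicator R) (real n / x)) n)
        \<le> ln (fps_nth (forest_fps (size_indicator R) (real m / x + real n / x)) (m + n))"
      using forest_fps_nth_pos[OF assms] assms by (intro ln_mono forest_fps_supermult mult_pos_pos) auto
    then show ?thesis using forest_fps_nth_pos[OF assms, of m] forest_fps_nth_pos[OF assms, of n]
      unfolding log_coeff_def by (simp add: ln_mult add_divide_distrib)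
  qed
  show "log_coeff R x 0 = 0" by (simp add: log_coeff_def forest_fps_def)
  show "log_coeff R x n \<le> (1 + 1 / (2 * x)) * real n" for n
  proof (cases "n = 0")
    case False
    then have t: "x / real n > 0" using assms by simp
    have "forest_poly R n (x / real n) \<le> forest_poly UNIV n (x / real n)" using t by (intro forest_poly_subset) auto
    then have "fps_nth (forest_fps (size_indicator R) (real n / x)) n \<le> fps_nth (forest_fps (size_indicator UNIV) (real n / x)) n"
      unfolding forest_poly_eq_fps[OF t] using t by (simp add: mult_le_cancel_left)
    also have "\<dots> \<le> exp (real n) * exp (real n / x / 2)"
      using forest_fps_upper[of "real n / x" n] assms by (simp add: size_indicator_UNIV)
    finally have "log_coeff R x n \<le> ln (exp (real n) * exp (real n / x / 2))"
      unfolding log_coeff_def using forest_fps_nth_pos[OF assms] by (intro ln_mono) auto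
    also have "\<dots> = (1 + 1 / (2 * x)) * real n" by (simp add: field_simps flip: exp_add)
    finally show ?thesis .
  qed (simp add: log_coeff_def forest_fps_def)
qed (use that in blast)

definition limit_rate :: "nat set \<Rightarrow> real \<Rightarrow> real" where
  "limit_rate R x = lim (\<lambda>n. growth_rate R n x)"

lemma growth_rate_lim_limit_rate:
  assumes "1 \<in> R" "x > 0"
  shows "(\<lambda>n. growth_rate R n x) \<longlonglongrightarrow> limit_rate R x"
    and "n \<ge> 1 \<Longrightarrow> ln x - 1 + log_coeff R x n / real n \<le> limit_rate R x"
proof -
  obtain L where L: "(\<lambda>n. log_coeff R x n / real n) \<longlonglongrightarrow> L" "\<And>n. n \<ge> 1 \<Longrightarrow> log_coeff R x n / real n \<le> L"
    using log_coeff_limit[OF assms] by blast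
  have "(\<lambda>n. ln x + (ln (fact n) / real n - ln (real n)) + log_coeff R x n / real n) \<longlonglongrightarrow> ln x + (-1) + L"
    by (intro tendsto_intros ln_fact_lim L)
  moreover have "\<forall>\<^sub>F n in sequentially. ln x + (ln (fact n) / real n - ln (real n)) + log_coeff R x n / real n = growth_rate R n x"
    using eventually_ge_at_top[of 1] by eventually_elim (use assms in \<open>auto simp: growth_rate_eq_log_coeff\<close>)
  ultimately have l: "(\<lambda>n. growth_rate R n x) \<longlonglongrightarrow> ln x + (-1) + L"
    by (rule Lim_transform_eventually)
  then have "limit_rate R x = ln x + (-1) + L" unfolding limit_rate_def by (rule limI)
  then show "(\<lambda>n. growth_rate R n x) \<longlonglongrightarrow> limit_rate R x" "n \<ge> 1 \<Longrightarrow> ln x - 1 + log_coeff R x n / real n \<le> limit_rate R x"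
    using l L(2)[of n] by auto
qed

text \<open>Trees of size at most \<open>r\<close> impose no restriction on \<open>r\<close> or fewer vertices. Since
  the limit for each \<open>r\<close> dominates the normalised value at every single \<open>n\<close>, it
  dominates the unrestricted value at every \<open>n \<le> r\<close>, and so it reaches the unrestricted limit
  as \<open>r\<close> grows.\<close>

lemma limit_rate_lim:
  assumes x: "x > 0"
  shows "(\<lambda>r. limit_rate {..r} x) \<longlonglongrightarrow> forest_rate x"
proof (rule order_tendstoI)
  fix a assume a: "forest_rate x < a"
  show "\<forall>\<^sub>F r in sequentially. limit_rate {..r} x < a"
    using eventually_ge_at_top[of 1]
  proof eventually_elim
    case (elim r)
    have "limit_rate {..r} x \<le> forest_rate x"
    proof (rule tendsto_le[OF _ growth_rate_lim[OF x] growth_rate_lim_limit_rate(1)[OF _ x]])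
      show "\<forall>\<^sub>F n in sequentially. growth_rate {..r} n x \<le> growth_rate UNIV n x"
        using eventually_ge_at_top[of 1]
      proof eventually_elim
        case (elim n)
        have "forest_poly {..r} n (x / real n) \<le> forest_poly UNIV n (x / real n)" "forest_poly {..r} n (x / real n) \<ge> 1"
          using x \<open>1 \<le> r\<close> by (auto intro!: forest_poly_subset forest_poly_ge_1)
        then show ?case unfolding growth_rate_def by (intro divide_right_mono ln_mono) auto
      qed
    qed (use elim in auto)
    then show ?case using a by simp
  qed
next
  fix a assume a: "a < forest_rate x"
  have "(\<lambda>n. growth_rate UNIV n x - (ln (fact n) / real n - ln (real n)) - 1) \<longlonglongrightarrow> forest_rate x - (-1) - 1"
    by (intro tendsto_intros growth_rate_lim x ln_fact_lim)
  then have "\<forall>\<^sub>F n in sequentially. a < growth_rate UNIV n x - (ln (fact n) / real n - ln (real n)) - 1"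
    by (rule order_tendstoD(1)) (use a in simp)
  then have "\<forall>\<^sub>F n in sequentially. a < growth_rate UNIV n x - (ln (fact n) / real n - ln (real n)) - 1 \<and> n \<ge> 1"
    using eventually_ge_at_top[of 1] by (rule eventually_conj)
  then obtain n where n: "a < growth_rate UNIV n x - (ln (fact n) / real n - ln (real n)) - 1" "n \<ge> 1"
    using eventually_happens'[OF sequentially_bot] by blast
  show "\<forall>\<^sub>F r in sequentially. a < limit_rate {..r} x"
    using eventually_ge_at_top[of n]
  proof eventually_elim
    case (elim r)
    then have "growth_rate {..r} n x = growth_rate UNIV n x" by (simp add: growth_rate_def forest_poly_def sized_forests_atMost)
    then have "ln x - 1 + log_coeff {..r} x n / real n > a"
      using growth_rate_eq_log_coeff[of "{..r}" n x] n elim x by simp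
    moreover have "ln x - 1 + log_coeff {..r} x n / real n \<le> limit_rate {..r} x"
      by (rule growth_rate_lim_limit_rate(2)) (use n elim x in auto)
    ultimately show ?case by simp
  qed
qed

lemma limit_rate_lipschitz:
  assumes "1 \<in> R" "0 < x" "0 < y"
  shows "\<bar>limit_rate R x - limit_rate R y\<bar> \<le> \<bar>ln x - ln y\<bar>"
proof (rule tendsto_upperbound)
  show "(\<lambda>n. \<bar>growth_rate R n x - growth_rate R n y\<bar>) \<longlonglongrightarrow> \<bar>limit_rate R x - limit_rate R y\<bar>"
    by (intro tendsto_intros growth_rate_lim_limit_rate assms)
  show "\<forall>\<^sub>F n in sequentially. \<bar>growth_rate R n x - growth_rate R n y\<bar> \<le> \<bar>ln x - ln y\<bar>"
    using eventually_ge_at_top[of 1] by eventually_elim (use growth_rate_lipschitz assms in auto)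
qed simp

section \<open>The random cluster weight\<close>

lemma adjacency_adj: "adjacency n \<omega> = adj (open_edges n \<omega>)"
  by (simp add: adjacency_def adj_def)

lemma components_comps: "components_of_config n \<omega> = comps {..<n} (open_edges n \<omega>)"
  by (simp add: components_of_config_def comps_def conn_def adjacency_adj)

lemma K_edges_pairs: "K_edges n = pairs {..<n}"
  by (simp add: K_edges_def pairs_def)

text \<open>The acyclic configurations, with and without a bound on the component sizes, are the cases
  \<open>R = {..r}\<close> and \<open>R = UNIV\<close>.\<close>

definition sized_event :: "nat set \<Rightarrow> nat \<Rightarrow> (nat set \<Rightarrow> nat) set" where
  "sized_event R n = {\<omega> \<in> event_L n. \<forall>C\<in>components_of_config n \<omega>. card C \<in> R}"

lemma event_L_sized: "event_L n = sized_event UNIV n"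
  by (simp add: sized_event_def)

lemma event_B_sized: "event_B n r \<inter> event_L n = sized_event {..r} n"
  by (auto simp: sized_event_def event_B_def event_L_def not_less)

lemma open_edges_sized: "\<omega> \<in> sized_event R n \<longleftrightarrow> \<omega> \<in> configs n \<and> open_edges n \<omega> \<in> sized_forests R n"
proof -
  have sub: "open_edges n \<omega> \<subseteq> pairs {..<n}" by (auto simp: open_edges_def K_edges_pairs)
  show ?thesis
    unfolding sized_event_def event_L_def sized_forests_def forests_def components_comps
    using acyc_iff_no_cycle[OF sub] sub by auto
qed

text \<open>Configurations correspond to their sets of open edges, and \<open>forest_card\<close> converts
  \<open>q ^ k(\<omega>)\<close> into \<open>q ^ n\<close> times a factor \<open>1 / q\<close> per edge.\<close>

lemma rc_weight_sized:
  assumes n: "n \<ge> 1" and l: "0 < l" "l < real n" and q: "q > 0"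
  defines "p \<equiv> l / real n"
  shows "rc_weight n l q (sized_event R n)
    = (1 - p) ^ card (pairs {..<n}) * q ^ n * forest_poly R n (p / (q * (1 - p)))"
proof -
  let ?P = "pairs {..<n}"
  have p: "0 < p" "p < 1" using l by (auto simp: p_def)
  have "rc_weight n l q (sized_event R n)
    = (\<Sum>\<omega>\<in>sized_event R n. (\<Prod>e\<in>?P. p ^ \<omega> e * (1 - p) ^ (1 - \<omega> e)) * q ^ num_components n \<omega>)"
    unfolding rc_weight_def Let_def p_def K_edges_pairs ..
  also have "\<dots> = (\<Sum>F\<in>sized_forests R n. (1 - p) ^ card ?P * q ^ n * (p / (q * (1 - p))) ^ card F)"
  proof (rule sum.reindex_bij_witness[of _ "\<lambda>F. restrict (\<lambda>e. if e \<in> F then 1 else 0) ?P" "open_edges n"])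
    fix \<omega> assume w: "\<omega> \<in> sized_event R n"
    then have c: "\<omega> \<in> ?P \<rightarrow>\<^sub>E {0, 1}" and F: "open_edges n \<omega> \<in> sized_forests R n"
      by (auto simp: open_edges_sized configs_def K_edges_pairs)
    have v: "\<omega> e = (if e \<in> open_edges n \<omega> then 1 else 0)" if "e \<in> ?P" for e
      using c that by (auto simp: open_edges_def K_edges_pairs PiE_iff)
    show "restrict (\<lambda>e. if e \<in> open_edges n \<omega> then 1 else 0) ?P = \<omega>"
      using c v by (intro extensionalityI[of _ ?P]) (auto simp: PiE_iff)
    show "open_edges n \<omega> \<in> sized_forests R n" by (rule F)
    let ?F = "open_edges n \<omega>"
    have sub: "?F \<subseteq> ?P" by (auto simp: open_edges_def K_edges_pairs)
    have "(\<Prod>e\<in>?P. p ^ \<omega> e * (1 - p) ^ (1 - \<omega> e)) = (\<Prod>e\<in>?P. if e \<in> ?F then p else 1 - p)"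
      by (rule prod.cong[OF refl]) (use v in auto)
    also have "\<dots> = p ^ card ?F * (1 - p) ^ card (?P - ?F)"
      using sub by (subst prod.If_cases) (simp_all add: Int_absorb1 Int_absorb2 Diff_eq)
    also have "\<dots> = (p / (1 - p)) ^ card ?F * (1 - p) ^ card ?P"
    proof -
      have "card ?P = card (?P - ?F) + card ?F"
        using sub by (metis add.commute card_mono card_Diff_subset finite_lessThan finite_pairs finite_subset le_add_diff_inverse)
      then show ?thesis using p by (simp add: power_add power_divide)
    qed
    finally have 1: "(\<Prod>e\<in>?P. p ^ \<omega> e * (1 - p) ^ (1 - \<omega> e)) = (p / (1 - p)) ^ card ?F * (1 - p) ^ card ?P" .
    have "num_components n \<omega> + card ?F = n"
      using forest_card[OF _ sized_forestsD[OF F]] by (simp add: num_components_def components_comps)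
    then have "q ^ n = q ^ num_components n \<omega> * q ^ card ?F" by (metis power_add)
    then have "q ^ num_components n \<omega> = q ^ n / q ^ card ?F" using q by simp
    then show "(1 - p) ^ card ?P * q ^ n * (p / (q * (1 - p))) ^ card ?F
       = (\<Prod>e\<in>?P. p ^ \<omega> e * (1 - p) ^ (1 - \<omega> e)) * q ^ num_components n \<omega>"
      unfolding 1 by (simp add: power_divide power_mult_distrib mult_ac)
  next
    fix F assume F: "F \<in> sized_forests R n"
    then have sub: "F \<subseteq> ?P" by (auto simp: sized_forests_def forests_def)
    let ?w = "restrict (\<lambda>e. if e \<in> F then 1 else 0) ?P :: nat set \<Rightarrow> nat"
    show o: "open_edges n ?w = F" using sub by (auto simp: open_edges_def K_edges_pairs)
    have "?w \<in> configs n" by (auto simp: configs_def K_edges_pairs)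
    then show "?w \<in> sized_event R n" using o F by (simp add: open_edges_sized)
  qed
  also have "\<dots> = (1 - p) ^ card ?P * q ^ n * forest_poly R n (p / (q * (1 - p)))"
    by (simp add: forest_poly_def sum_distrib_left)
  finally show ?thesis .
qed

lemma ln_rc_weight:
  assumes R: "1 \<in> R" and n: "n \<ge> 1" and l: "0 < l" "l < real n" and q: "q > 0"
  shows "ln (rc_weight n l q (sized_event R n)) / real n
    = (real n - 1) / 2 * ln (1 - l / real n) + ln q + growth_rate R n (l / q / (1 - l / real n))"
proof -
  let ?p = "l / real n"
  have p: "0 < ?p" "?p < 1" using l by auto
  have x: "?p / (q * (1 - ?p)) = l / q / (1 - ?p) / real n" by (simp add: field_simps)
  have pos: "?p / (q * (1 - ?p)) \<ge> 0" by (intro divide_nonneg_pos mult_pos_pos) (use l n p q in auto)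
  have S0: "forest_poly R n (?p / (q * (1 - ?p))) > 0" using forest_poly_ge_1[OF R pos, of n] by linarith
  have log: "ln (a ^ N * q ^ n * W) = real N * ln a + real n * ln q + ln W" if "a > 0" "W > 0" for a N W
    using that q by (simp add: ln_mult ln_realpow)
  have "ln (rc_weight n l q (sized_event R n))
      = real (card (pairs {..<n})) * ln (1 - ?p) + real n * ln q + ln (forest_poly R n (?p / (q * (1 - ?p))))"
    unfolding rc_weight_sized[OF n l q] by (rule log[OF _ S0]) (use p in simp)
  also have "\<dots> = real n * ((real n - 1) / 2 * ln (1 - ?p) + ln q) + ln (forest_poly R n (l / q / (1 - ?p) / real n))"
    unfolding card_pairs x by (simp add: algebra_simps)
  finally show ?thesis unfolding growth_rate_def using n by (simp add: add_divide_distrib)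
qed

text \<open>Equicontinuity turns pointwise convergence on a finite net into uniform convergence.\<close>

lemma uniform_limit_log_lipschitz:
  fixes f :: "nat \<Rightarrow> real \<Rightarrow> real"
  assumes K: "compact K" "K \<subseteq> {0<..}"
    and lip: "\<And>n x y. n \<ge> 1 \<Longrightarrow> 0 < x \<Longrightarrow> 0 < y \<Longrightarrow> \<bar>f n x - f n y\<bar> \<le> \<bar>ln x - ln y\<bar>"
    and lim: "\<And>x. 0 < x \<Longrightarrow> (\<lambda>n. f n x) \<longlonglongrightarrow> g x"
  shows "uniform_limit K f g sequentially"
proof (rule uniform_limitI)
  fix e :: real assume e: "e > 0"
  have glip: "\<bar>g x - g y\<bar> \<le> \<bar>ln x - ln y\<bar>" if "0 < x" "0 < y" for x y
  proof (rule tendsto_upperbound)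
    show "(\<lambda>n. \<bar>f n x - f n y\<bar>) \<longlonglongrightarrow> \<bar>g x - g y\<bar>" by (intro tendsto_intros lim that)
    show "\<forall>\<^sub>F n in sequentially. \<bar>f n x - f n y\<bar> \<le> \<bar>ln x - ln y\<bar>"
      using eventually_ge_at_top[of 1] by eventually_elim (use lip that in auto)
  qed simp
  have "continuous_on K ln" using K(2) by (intro continuous_on_ln continuous_on_id) auto
  then have "compact (ln ` K)" using K(1) by (rule compact_continuous_image)
  then obtain N where N: "finite N" "ln ` K \<subseteq> (\<Union>u\<in>N. ball u (e / 3))"
    using e unfolding compact_eq_totally_bounded by (meson divide_pos_pos zero_less_numeral)
  have "\<forall>\<^sub>F n in sequentially. \<forall>u\<in>N. dist (f n (exp u)) (g (exp u)) < e / 3"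
    using N(1) e by (intro eventually_ball_finite ballI tendstoD[OF lim]) auto
  then show "\<forall>\<^sub>F n in sequentially. \<forall>x\<in>K. dist (f n x) (g x) < e"
    using eventually_ge_at_top[of 1]
  proof eventually_elim
    case (elim n)
    show ?case
    proof
      fix x assume "x \<in> K"
      then have x: "0 < x" using K(2) by auto
      obtain u where u: "u \<in> N" "\<bar>ln x - u\<bar> < e / 3"
      proof -
        have "ln x \<in> (\<Union>u\<in>N. ball u (e / 3))" using N(2) \<open>x \<in> K\<close> by blast
        then show ?thesis using that by (auto simp: dist_real_def abs_minus_commute)
      qed
      have "\<bar>f n x - f n (exp u)\<bar> \<le> \<bar>ln x - u\<bar>" using lip[of n x "exp u"] elim x by simp
      moreover have "\<bar>g x - g (exp u)\<bar> \<le> \<bar>ln x - u\<bar>" using glip[of x "exp u"] x by simp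
      moreover have "\<bar>f n (exp u) - g (exp u)\<bar> < e / 3" using elim(1) u(1) by (auto simp: dist_real_def)
      ultimately show "dist (f n x) (g x) < e" using u(2) unfolding dist_real_def by linarith
    qed
  qed
qed

text \<open>The argument \<open>l / q / (1 - l / n)\<close> at which the growth rate is evaluated differs from
  \<open>l / q\<close> by a factor tending to \<open>1\<close>, so the Lipschitz bound replaces one by the
  other; the factor \<open>(1 - l / n) ^ (n * (n - 1) / 2)\<close> yields the summand \<open>- l / 2\<close>.\<close>

lemma rc_uniform_limit:
  assumes R: "1 \<in> R" and q: "q > 0" and K: "compact K" "K \<subseteq> {0<..}"
    and lim: "\<And>x. x > 0 \<Longrightarrow> (\<lambda>n. growth_rate R n x) \<longlonglongrightarrow> g x"
  shows "uniform_limit K (\<lambda>n l. ln (rc_weight n l q (sized_event R n)) / real n)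
    (\<lambda>l. - l / 2 + ln q + g (l / q)) sequentially"
proof -
  let ?F = "\<lambda>n l. ln (rc_weight n l q (sized_event R n)) / real n"
  have 1: "uniform_limit K (\<lambda>n l. growth_rate R n (l / q)) (\<lambda>l. g (l / q)) sequentially"
  proof (rule uniform_limit_log_lipschitz[OF K])
    fix n :: nat and x y :: real assume "n \<ge> 1" "0 < x" "0 < y"
    then show "\<bar>growth_rate R n (x / q) - growth_rate R n (y / q)\<bar> \<le> \<bar>ln x - ln y\<bar>"
      using growth_rate_lipschitz[OF R, of n "x / q" "y / q"] q by (simp add: ln_div)
  qed (use lim q in simp)
  have "bounded K" using K(1) by (rule compact_imp_bounded)
  then obtain M where M: "M > 0" "\<And>l. l \<in> K \<Longrightarrow> \<bar>l\<bar> \<le> M" unfolding bounded_pos by auto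
  have "uniform_limit K (\<lambda>n l. ?F n l - growth_rate R n (l / q)) (\<lambda>l. - l / 2 + ln q) sequentially"
  proof (rule uniform_limitI)
    fix e :: real assume e: "e > 0"
    \<comment> \<open>The second-order bounds for \<open>ln (1 - l / n)\<close> give this error, uniformly for \<open>l \<le> M\<close>.\<close>
    have "(\<lambda>n. (2 * M + 3 * M\<^sup>2) * (1 / real n)) \<longlonglongrightarrow> (2 * M + 3 * M\<^sup>2) * 0"
      by (intro tendsto_intros lim_1_over_n)
    then have "\<forall>\<^sub>F n in sequentially. (2 * M + 3 * M\<^sup>2) * (1 / real n) < e"
      by (rule order_tendstoD(2)) (use e in simp)
    moreover have "\<forall>\<^sub>F n in sequentially. real n \<ge> 2 * M + 1"
      by real_asymp
    ultimately show "\<forall>\<^sub>F n in sequentially. \<forall>l\<in>K. dist (?F n l - growth_rate R n (l / q)) (- l / 2 + ln q) < e"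
    proof eventually_elim
      case (elim n)
      show ?case
      proof
        fix l assume "l \<in> K"
        then have l: "0 < l" "l \<le> M" using K(2) M(2)[of l] by auto
        have n: "n \<ge> 1" "real n > 0" "l < real n" using elim(2) l M(1) by auto
        define y where "y = l / real n"
        let ?L = "ln (1 - y)"
        have y: "0 < y" "y \<le> 1 / 2" using n l elim(2) by (auto simp: y_def field_simps)
        have y1: "0 < 1 - y" using y by linarith
        have up: "?L \<le> - y" using y by (intro ln_one_minus_pos_upper_bound) linarith+
        have lo: "- y - 2 * y\<^sup>2 \<le> ?L" using y by (intro ln_one_minus_pos_lower_bound) linarith+
        have eq: "?F n l = (real n - 1) / 2 * ?L + ln q + growth_rate R n (l / q / (1 - y))"
          unfolding y_def by (rule ln_rc_weight[OF R n(1) l(1) n(3) q])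
        have "\<bar>growth_rate R n (l / q / (1 - y)) - growth_rate R n (l / q)\<bar> \<le> \<bar>ln (l / q / (1 - y)) - ln (l / q)\<bar>"
          by (rule growth_rate_lipschitz[OF R n(1)]) (use l q y1 in \<open>auto intro!: divide_pos_pos\<close>)
        also have "ln (l / q / (1 - y)) = ln (l / q) - ?L"
        proof -
          have "ln (a / b) = ln a - ln b" if "a > 0" "b > 0" for a b :: real
            using that by (simp add: ln_div)
          from this[of "l / q" "1 - y"] show ?thesis using l q y1 by fastforce
        qed
        also have "\<bar>ln (l / q) - ?L - ln (l / q)\<bar> = - ?L" using y up by linarith
        finally have A: "\<bar>growth_rate R n (l / q / (1 - y)) - growth_rate R n (l / q)\<bar> \<le> y + 2 * y\<^sup>2" using lo by linarith
        have "(real n - 1) / 2 * ?L \<le> (real n - 1) / 2 * - y"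
          using up n by (intro mult_left_mono) auto
        also have "\<dots> = - l / 2 + y / 2" using n by (simp add: y_def field_simps)
        finally have B: "(real n - 1) / 2 * ?L \<le> - l / 2 + y / 2" .
        have "(real n - 1) / 2 * (- y - 2 * y\<^sup>2) \<le> (real n - 1) / 2 * ?L"
          using lo n by (intro mult_left_mono) auto
        moreover have "(real n - 1) / 2 * (- y - 2 * y\<^sup>2) = - l / 2 + y / 2 - l * y + y\<^sup>2"
          using n by (simp add: y_def field_simps power2_eq_square)
        ultimately have C: "- l / 2 - l * y \<le> (real n - 1) / 2 * ?L"
          using y zero_le_power2[of y] by linarith
        have "y\<^sup>2 \<le> l * y" using n l by (simp add: y_def power2_eq_square field_simps)
        moreover have "y \<le> M * (1 / real n)" using n l by (simp add: y_def field_simps)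
        moreover have "l * y \<le> M\<^sup>2 * (1 / real n)"
          using mult_mono[OF l(2) l(2)] n l M(1) by (simp add: y_def power2_eq_square divide_right_mono)
        moreover have "M * (1 / real n) \<ge> 0" "M\<^sup>2 * (1 / real n) \<ge> 0" using M(1) by auto
        ultimately have "\<bar>(real n - 1) / 2 * ?L + l / 2 + (growth_rate R n (l / q / (1 - y)) - growth_rate R n (l / q))\<bar>
            \<le> 2 * (M * (1 / real n)) + 3 * (M\<^sup>2 * (1 / real n))"
          using A B C by linarith
        also have "\<dots> = (2 * M + 3 * M\<^sup>2) * (1 / real n)" by (simp only: distrib_right mult.assoc)
        also have "\<dots> < e" by (rule elim(1))
        finally show "dist (?F n l - growth_rate R n (l / q)) (- l / 2 + ln q) < e"
          unfolding dist_real_def eq by (simp add: algebra_simps)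
      qed
    qed
  qed
  from uniform_limit_add[OF this 1] show ?thesis by simp
qed

lemma ln_le_half_diff:
  fixes x :: real
  assumes "x \<ge> 1"
  shows "ln x \<le> (x - 1 / x) / 2"
proof -
  let ?h = "\<lambda>x::real. (x - 1 / x) / 2 - ln x"
  have "?h 1 \<le> ?h x"
  proof (rule DERIV_nonneg_imp_nondecreasing[OF assms])
    fix y :: real assume y: "1 \<le> y"
    have "(?h has_real_derivative ((1 + 1 / y\<^sup>2) / 2 - 1 / y)) (at y)"
      using y by (auto intro!: derivative_eq_intros simp: power2_eq_square field_simps)
    moreover have "(1 + 1 / y\<^sup>2) / 2 - 1 / y = (1 - 1 / y)\<^sup>2 / 2"
      using y by (simp add: power2_eq_square field_simps)
    ultimately show "\<exists>z. (?h has_real_derivative z) (at y) \<and> 0 \<le> z"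
      by (metis divide_nonneg_pos zero_le_power2 zero_less_numeral)
  qed
  then show ?thesis by simp
qed

text \<open>The minimum in \<open>Psi\<close> switches at \<open>1\<close>, because \<open>ln x\<close> and
  \<open>(x - 1 / x) / 2\<close> cross there.\<close>

lemma Psi_eq_forest_rate: "x > 0 \<Longrightarrow> Psi x = forest_rate x - x / 2"
proof (cases "x \<le> 1")
  assume x: "x > 0"
  case True
  have "ln (1 / x) \<le> (1 / x - 1 / (1 / x)) / 2" by (rule ln_le_half_diff) (use x True in simp)
  then show ?thesis using x True by (simp add: Psi_def forest_rate_def ln_div)
next
  assume x: "x > 0"
  case False
  then show ?thesis using ln_le_half_diff[of x] x by (simp add: Psi_def forest_rate_def field_simps)
qed

theorem theorem2p4:
  fixes q :: real
  assumes "q > 0"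
  defines "F \<equiv> (\<lambda>n l. ln (rc_weight n l q (event_L n)) / real n)"
    and "F_B \<equiv> (\<lambda>r n l. ln (rc_weight n l q (event_B n r \<inter> event_L n)) / real n)"
    and "\<Phi> \<equiv> (\<lambda>l. Psi (l / q) - (q - 1) / (2 * q) * l + ln q)"
  shows "\<exists>G :: nat \<Rightarrow> real \<Rightarrow> real.
    (\<forall>l>0. (\<lambda>n. F n l) \<longlonglongrightarrow> \<Phi> l
         \<and> (\<forall>r\<ge>1. (\<lambda>n. F_B r n l) \<longlonglongrightarrow> G r l)
         \<and> (\<lambda>r. G r l) \<longlonglongrightarrow> \<Phi> l)
    \<and> (\<forall>K. compact K \<and> K \<subseteq> {0<..} - {q} \<longrightarrow>
           uniform_limit K F \<Phi> sequentially
         \<and> (\<forall>r\<ge>1. uniform_limit K (F_B r) (G r) sequentially)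
         \<and> uniform_limit K G \<Phi> sequentially)"
proof -
  define G where "G r l = - l / 2 + ln q + limit_rate {..r} (l / q)" for r l
  have Phi: "\<Phi> l = - l / 2 + ln q + forest_rate (l / q)" if "l > 0" for l
    using that assms(1) Psi_eq_forest_rate[of "l / q"] by (simp add: \<Phi>_def field_simps)
  have main: "uniform_limit K F \<Phi> sequentially" (is ?A)
    "\<And>r. r \<ge> 1 \<Longrightarrow> uniform_limit K (F_B r) (G r) sequentially"
    "uniform_limit K G \<Phi> sequentially" (is ?C)
    if K: "compact K" "K \<subseteq> {0<..}" for K
  proof -
    have K0: "l > 0" if "l \<in> K" for l using K(2) that by auto
    have cong: "uniform_limit K f \<Phi> sequentially \<longleftrightarrow> uniform_limit K f (\<lambda>l. - l / 2 + ln q + forest_rate (l / q)) sequentially" for f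
      by (rule uniform_limit_cong') (use K0 Phi in auto)
    show ?A unfolding cong
      unfolding F_def event_L_sized by (rule rc_uniform_limit[OF _ assms(1) K growth_rate_lim]) simp
    show "uniform_limit K (F_B r) (G r) sequentially" if "r \<ge> 1" for r
      unfolding F_B_def G_def[abs_def] event_B_sized
      by (rule rc_uniform_limit[OF _ assms(1) K growth_rate_lim_limit_rate(1)]) (use that in auto)
    have "uniform_limit K (\<lambda>r l. limit_rate {..r} (l / q)) (\<lambda>l. forest_rate (l / q)) sequentially"
    proof (rule uniform_limit_log_lipschitz[OF K])
      fix r :: nat and x y :: real assume "r \<ge> 1" "0 < x" "0 < y"
      then show "\<bar>limit_rate {..r} (x / q) - limit_rate {..r} (y / q)\<bar> \<le> \<bar>ln x - ln y\<bar>"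
        using limit_rate_lipschitz[of "{..r}" "x / q" "y / q"] assms(1) by (simp add: ln_div)
    qed (use limit_rate_lim assms(1) in simp)
    then have "uniform_limit K (\<lambda>r l. - l / 2 + ln q + limit_rate {..r} (l / q)) (\<lambda>l. - l / 2 + ln q + forest_rate (l / q)) sequentially"
      by (intro uniform_limit_add uniform_limit_const)
    then show ?C unfolding G_def[abs_def] cong .
  qed
  \<comment> \<open>Pointwise convergence is uniform convergence on a single point.\<close>
  have point: "(\<lambda>n. F n l) \<longlonglongrightarrow> \<Phi> l" "\<And>r. r \<ge> 1 \<Longrightarrow> (\<lambda>n. F_B r n l) \<longlonglongrightarrow> G r l"
    "(\<lambda>r. G r l) \<longlonglongrightarrow> \<Phi> l" if "l > 0" for l
    using main[of "{l}"] that by (auto intro: tendsto_uniform_limitI)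
  show ?thesis
  proof (intro exI[of _ G] conjI allI impI)
    fix K :: "real set" assume "compact K \<and> K \<subseteq> {0<..} - {q}"
    then have K: "compact K" "K \<subseteq> {0<..}" by auto
    show "uniform_limit K F \<Phi> sequentially" "uniform_limit K G \<Phi> sequentially"
      by (rule main[OF K])+
    show "uniform_limit K (F_B r) (G r) sequentially" if "r \<ge> 1" for r
      by (rule main(2)[OF K that])
  qed (use point in auto)
qed

end
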